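(* Let $\epsilon$ be a real number with $0 < \epsilon \leq \frac{1}{2}$ and let $p$ be a prime with $p \geq \max\{75^{3/\epsilon}, e^{100}\}$ (i.e. $p^{\epsilon/3} \geq 75$ and $p \geq e^{100}$). Then \[ \#\left\{ q \text{ prime} : p^{\epsilon/3} < q \leq 72\, p^{\frac{1}{2}+\epsilon},\ q \text{ is a cubic residue modulo } p \right\} \;\geq\; \frac{1}{15}\, p^{\epsilon/3}. \]
   Context: A prime $q$ is a cubic residue modulo $p$ if $q \not\equiv 0 \pmod p$ and $q \equiv y^3 \pmod p$ for some integer $y$. *)

theory Defs
  imports Complex_Main "HOL-Number_Theory.Number_Theory"
begin

definition cubic_residue :: "int \<Rightarrow> nat \<Rightarrow> bool" where
  "cubic_residue q p \<longleftrightarrow> \<not> [q = 0] (mod int p) \<and> (\<exists>y::int. [q = y ^ 3] (mod int p))"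

end

theory Submission
  imports Defs "HOL-Computational_Algebra.Polynomial"
begin

text \<open>
  If \<open>p \<equiv> 2 (mod 3)\<close>, every \<open>q \<noteq> p\<close> is a cubic residue and only a count of primes is needed.
  If \<open>p \<equiv> 1 (mod 3)\<close>, a cubic Jacobi sum \<open>J = a + 3m\<omega>\<close> has norm \<open>p\<close>, and cubic reciprocity (via the
  Gauss sum \<open>g\<close> with \<open>g\<^sup>3 = pJ\<close>) shows that every prime \<open>q \<noteq> 3, p\<close> dividing a value of the cubic polynomial
  \<open>F(x) = m(x\<^sup>3 - 3x\<^sup>2 + 1) + a(x\<^sup>2 - x)\<close> is a cubic residue: \<open>3F(x)\<close> is the \<open>\<omega>\<close>-coefficient
  of \<open>J(x + \<omega>)\<^sup>3\<close>, so \<open>q | F(x)\<close> makes \<open>J(x + \<omega>)\<^sup>3\<close> congruent to its conjugate, hence \<open>pJ\<close>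
  congruent to a cube.

  Put \<open>Y = p powr (\<epsilon> / 3)\<close>. For \<open>2 \<le> x \<le> 17Y/3\<close> the values are at most \<open>72 \<surd>p Y\<^sup>3\<close>. If fewer than \<open>Y / 15\<close> primes
  above \<open>Y\<close> divided them, then discarding at most three arguments for each prime involved would
  leave, by an argument of Erdos, a product dividing a cube of a factorial. This contradicts the lower
  bound \<open>|F(x)| \<ge> c n\<^sup>2 \<surd>p\<close>, valid for most \<open>x \<le> n\<close>.
\<close>

section \<open>Congruences in subrings and Eisenstein integers\<close>

locale comm_subring =
  fixes S :: "'a :: comm_ring_1 set"
  assumes one_mem: "1 \<in> S"
    and diff_mem: "x \<in> S \<Longrightarrow> y \<in> S \<Longrightarrow> x - y \<in> S"
    and mult_mem: "x \<in> S \<Longrightarrow> y \<in> S \<Longrightarrow> x * y \<in> S"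
begin

lemma zero_mem: "0 \<in> S"
  using diff_mem[OF one_mem one_mem] by simp

lemma uminus_mem: "x \<in> S \<Longrightarrow> - x \<in> S"
  using diff_mem[OF zero_mem] by simp

lemma add_mem: "x \<in> S \<Longrightarrow> y \<in> S \<Longrightarrow> x + y \<in> S"
  using diff_mem[of x "- y"] uminus_mem by simp

lemma sum_mem: "(\<And>i. i \<in> A \<Longrightarrow> f i \<in> S) \<Longrightarrow> sum f A \<in> S"
  by (induction A rule: infinite_finite_induct) (auto intro: zero_mem add_mem)

lemma of_nat_mem: "of_nat n \<in> S"
  by (induction n) (auto intro: zero_mem add_mem one_mem)

lemma of_int_mem: "of_int n \<in> S"
  by (cases n) (auto simp del: of_nat_Suc intro!: of_nat_mem uminus_mem)

lemma power_mem: "x \<in> S \<Longrightarrow> x ^ n \<in> S"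
  by (induction n) (auto intro: one_mem mult_mem)

text \<open>Congruence modulo the ideal \<open>n S\<close>, with the quotient taken in
  \<open>S\<close> itself: in the complex numbers division by a nonzero \<open>n\<close> is always
  possible and the relation would be trivial. The same notion serves the Eisenstein integers and the
  polynomials over them.\<close>

definition scong :: "int \<Rightarrow> 'a \<Rightarrow> 'a \<Rightarrow> bool" where
  "scong n x y \<longleftrightarrow> (\<exists>z\<in>S. x - y = of_int n * z)"

lemma scong_refl [simp]: "scong n x x"
  unfolding scong_def by (intro bexI[of _ 0]) (auto intro: zero_mem)

lemma scong_sym: "scong n x y \<Longrightarrow> scong n y x"
proof -
  assume "scong n x y"
  then obtain z where "z \<in> S" "x - y = of_int n * z"
    by (auto simp: scong_def)
  then have "y - x = of_int n * (- z)"
    by (simp add: algebra_simps)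
  with \<open>z \<in> S\<close> show ?thesis
    unfolding scong_def using uminus_mem by blast
qed

lemma scong_add:
  assumes "scong n x y" "scong n x' y'"
  shows "scong n (x + x') (y + y')"
proof -
  obtain z z' where "z \<in> S" "x - y = of_int n * z" "z' \<in> S" "x' - y' = of_int n * z'"
    using assms by (auto simp: scong_def)
  moreover from this have "(x + x') - (y + y') = of_int n * (z + z')"
    by (simp add: algebra_simps)
  ultimately show ?thesis
    unfolding scong_def using add_mem by blast
qed

lemma scong_trans [trans]:
  assumes "scong n x y" "scong n y z"
  shows "scong n x z"
  using scong_add[OF assms] by (simp add: scong_def)

lemma scong_mult:
  assumes "scong n x y" "scong n x' y'" "x \<in> S" "y' \<in> S"
  shows "scong n (x * x') (y * y')"
proof -
  obtain z z' where "z \<in> S" "x - y = of_int n * z" "z' \<in> S" "x' - y' = of_int n * z'"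
    using assms by (auto simp: scong_def)
  moreover have "x * x' - y * y' = x * (x' - y') + (x - y) * y'"
    by (simp add: algebra_simps)
  ultimately have "x * x' - y * y' = of_int n * (x * z' + z * y')"
    by (simp add: algebra_simps)
  with \<open>z \<in> S\<close> \<open>z' \<in> S\<close> assms show ?thesis
    unfolding scong_def using add_mem mult_mem by blast
qed

lemma scong_power:
  assumes "scong n x y" "x \<in> S" "y \<in> S"
  shows "scong n (x ^ k) (y ^ k)"
  by (induction k) (auto intro: scong_mult power_mem assms)

lemma scong_sum: "(\<And>i. i \<in> A \<Longrightarrow> scong n (f i) (g i)) \<Longrightarrow> scong n (sum f A) (sum g A)"
  by (induction A rule: infinite_finite_induct) (auto intro: scong_add)

lemma scong_of_int:
  assumes "[a = b] (mod n)"
  shows "scong n (of_int a) (of_int b)"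
proof -
  obtain k where "a - b = n * k"
    using assms by (auto simp: cong_iff_dvd_diff dvd_def)
  then have "of_int a - of_int b = (of_int n * of_int k :: 'a)"
    by (metis of_int_diff of_int_mult)
  then show ?thesis
    unfolding scong_def using of_int_mem by blast
qed

lemma scong_cancel_of_int:
  assumes "coprime m n" "scong n (of_int m * x) (of_int m * y)" "x \<in> S" "y \<in> S"
  shows "scong n x y"
proof -
  obtain k where k: "[m * k = 1] (mod n)"
    using assms(1) coprime_iff_invertible_int by auto
  have *: "scong n (of_int (m * k) * z) z" if "z \<in> S" for z
    using scong_mult[OF scong_of_int[OF k] scong_refl of_int_mem that] by simp
  have "scong n x (of_int (m * k) * x)"
    using * assms scong_sym by blast
  also have "scong n (of_int (m * k) * x) (of_int (m * k) * y)"
    using scong_mult[OF scong_refl[of n "of_int k"] assms(2)] assms(3,4)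
    by (simp add: mult_mem of_int_mem algebra_simps)
  also have "scong n (of_int (m * k) * y) y"
    using * assms by blast
  finally show ?thesis .
qed

lemma scong_freshman_add:
  assumes "prime q" "x \<in> S" "y \<in> S"
  shows "scong (int q) ((x + y) ^ q) (x ^ q + y ^ q)"
proof -
  have q: "q > 0" using assms(1) prime_gt_0_nat by blast
  have "(x + y) ^ q = (\<Sum>k\<le>q. of_nat (q choose k) * x ^ k * y ^ (q - k))"
    by (rule binomial_ring)
  also have "{..q} = insert 0 (insert q {0<..<q})"
    using q by auto
  also have "(\<Sum>k\<in>\<dots>. of_nat (q choose k) * x ^ k * y ^ (q - k)) =
      y ^ q + x ^ q + (\<Sum>k\<in>{0<..<q}. of_nat (q choose k) * x ^ k * y ^ (q - k))"
    using q by simp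
  finally have "(x + y) ^ q = (x ^ q + y ^ q) +
      (\<Sum>k\<in>{0<..<q}. of_nat (q choose k) * x ^ k * y ^ (q - k))" by simp
  moreover have "scong (int q) (\<Sum>k\<in>{0<..<q}. of_nat (q choose k) * x ^ k * y ^ (q - k))
      (\<Sum>k\<in>{0<..<q}. 0)"
  proof (rule scong_sum)
    fix k assume k: "k \<in> {0<..<q}"
    then have "q dvd (q choose k)"
      using dvd_choose_prime assms(1) by auto
    then obtain c where "q choose k = q * c" by (elim dvdE)
    then have "of_nat (q choose k) * x ^ k * y ^ (q - k) - 0
        = of_int (int q) * (of_nat c * x ^ k * y ^ (q - k))"
      by (simp add: algebra_simps)
    moreover have "of_nat c * x ^ k * y ^ (q - k) \<in> S"
      by (intro mult_mem of_nat_mem power_mem assms)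
    ultimately show "scong (int q) (of_nat (q choose k) * x ^ k * y ^ (q - k)) 0"
      unfolding scong_def by blast
  qed
  ultimately show ?thesis
    using scong_add[OF scong_refl] by fastforce
qed

lemma scong_freshman_sum:
  assumes "prime q" "\<And>i. i \<in> A \<Longrightarrow> f i \<in> S"
  shows "scong (int q) ((\<Sum>i\<in>A. f i) ^ q) (\<Sum>i\<in>A. f i ^ q)"
  using assms(2)
proof (induction A rule: infinite_finite_induct)
  case (insert a A)
  have "scong (int q) ((f a + sum f A) ^ q) (f a ^ q + sum f A ^ q)"
    using insert.prems by (intro scong_freshman_add assms(1) sum_mem) auto
  also have "scong (int q) (f a ^ q + sum f A ^ q) (f a ^ q + (\<Sum>i\<in>A. f i ^ q))"
    using insert by (intro scong_add) auto
  finally show ?case using insert by simp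
\<comment> \<open>Over an empty or infinite index set both sums are 0, and \<open>0 ^ q = 0\<close>
  because \<open>q > 0\<close>.\<close>
qed (use prime_gt_0_nat[OF assms(1)] in \<open>auto simp: power_0_left\<close>)

lemma scong_freshman:
  assumes "prime q" "\<And>i. i \<in> A \<Longrightarrow> f i \<in> S"
  shows "scong (int q) ((\<Sum>i\<in>A. f i) ^ (q ^ k)) (\<Sum>i\<in>A. f i ^ (q ^ k))"
proof (induction k)
  case (Suc k)
  have "scong (int q) (((\<Sum>i\<in>A. f i) ^ (q ^ k)) ^ q) ((\<Sum>i\<in>A. f i ^ (q ^ k)) ^ q)"
    by (intro scong_power Suc power_mem sum_mem assms)
  also have "scong (int q) \<dots> (\<Sum>i\<in>A. (f i ^ (q ^ k)) ^ q)"
    by (intro scong_freshman_sum assms power_mem)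
  finally show ?case
    by (simp add: power_mult[symmetric] mult.commute)
qed auto

end

text \<open>Makes the Frobenius congruence available for the Gauss sum, which is treated as a
  polynomial with Eisenstein coefficients.\<close>

lemma comm_subring_polys:
  assumes "comm_subring S"
  shows "comm_subring {P :: 'a :: comm_ring_1 poly. \<forall>i. coeff P i \<in> S}"
proof -
  interpret comm_subring S by fact
  show ?thesis
    by standard (auto simp: coeff_1 coeff_mult one_mem zero_mem intro!: diff_mem sum_mem mult_mem)
qed

section \<open>The Eisenstein integers and Fermat's theorem in them\<close>

definition omega :: complex where
  "omega = Complex (- 1 / 2) (sqrt 3 / 2)"

lemma omega_sq: "omega ^ 2 = - 1 - omega"
  by (simp add: omega_def power2_eq_square complex_eq_iff)

lemma omega_mult_omega: "omega * omega = - 1 - omega"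
  using omega_sq by (simp add: power2_eq_square)

lemma omega_cubed: "omega ^ 3 = 1"
  by (simp add: power3_eq_cube omega_mult_omega algebra_simps)

lemma cnj_omega: "cnj omega = - 1 - omega"
  by (simp add: omega_def complex_eq_iff)

lemma omega_power_mod: "omega ^ (n mod 3) = omega ^ n"
  by (metis (no_types) div_mult_mod_eq power_add power_mult omega_cubed power_one mult_1 mult.commute)

definition eisenstein :: "complex set" where
  "eisenstein = {of_int a + of_int b * omega | a b. True}"

lemma eisensteinI: "of_int a + of_int b * omega \<in> eisenstein"
  by (auto simp: eisenstein_def)

lemma eisenstein_eq_iff:
  "of_int a + of_int b * omega = of_int c + of_int d * omega \<longleftrightarrow> a = c \<and> b = d"
proof
  assume *: "of_int a + of_int b * omega = of_int c + of_int d * omega"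
  from arg_cong[OF *, of Im] have "b = d" by (simp add: omega_def)
  with * show "a = c \<and> b = d" by simp
qed auto

interpretation eisenstein: comm_subring eisenstein
proof
  show "1 \<in> eisenstein"
    using eisensteinI[of 1 0] by simp
  fix x y assume "x \<in> eisenstein" "y \<in> eisenstein"
  then obtain a b c d where x: "x = of_int a + of_int b * omega" and y: "y = of_int c + of_int d * omega"
    by (auto simp: eisenstein_def)
  have "x - y = of_int (a - c) + of_int (b - d) * omega"
    by (simp add: x y algebra_simps)
  then show "x - y \<in> eisenstein" using eisensteinI by metis
  have "x * y = of_int a * of_int c + (of_int a * of_int d + of_int b * of_int c) * omega
      + of_int b * of_int d * (omega * omega)"
    by (simp add: x y algebra_simps)
  also have "\<dots> = of_int (a * c - b * d) + of_int (a * d + b * c - b * d) * omega"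
    by (simp add: omega_mult_omega algebra_simps)
  finally show "x * y \<in> eisenstein" using eisensteinI by metis
qed

lemma omega_mem: "omega \<in> eisenstein"
  using eisensteinI[of 0 1] by simp

lemma cnj_mem_eisenstein:
  assumes "x \<in> eisenstein"
  shows "cnj x \<in> eisenstein"
proof -
  obtain a b where "x = of_int a + of_int b * omega"
    using assms by (auto simp: eisenstein_def)
  then have "cnj x = of_int (a - b) + of_int (- b) * omega"
    by (simp add: cnj_omega algebra_simps)
  then show ?thesis using eisensteinI by metis
qed

lemma scong_eisenstein_iff:
  "eisenstein.scong n (of_int a + of_int b * omega) (of_int c + of_int d * omega) \<longleftrightarrow>
     [a = c] (mod n) \<and> [b = d] (mod n)"
proof
  assume "eisenstein.scong n (of_int a + of_int b * omega) (of_int c + of_int d * omega)"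
  then obtain z where "z \<in> eisenstein"
    and z: "of_int a + of_int b * omega - (of_int c + of_int d * omega) = of_int n * z"
    by (auto simp: eisenstein.scong_def)
  then obtain u v where "z = of_int u + of_int v * omega"
    by (auto simp: eisenstein_def)
  with z have "of_int (a - c) + of_int (b - d) * omega = of_int (n * u) + of_int (n * v) * omega"
    by (simp add: algebra_simps)
  then have "a - c = n * u" "b - d = n * v"
    by (simp_all only: eisenstein_eq_iff)
  then show "[a = c] (mod n) \<and> [b = d] (mod n)"
    by (auto simp: cong_iff_dvd_diff)
next
  assume "[a = c] (mod n) \<and> [b = d] (mod n)"
  then show "eisenstein.scong n (of_int a + of_int b * omega) (of_int c + of_int d * omega)"
    by (intro eisenstein.scong_add eisenstein.scong_mult eisenstein.scong_of_int)
       (auto intro: omega_mem eisenstein.of_int_mem)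
qed

lemma fermat_int:
  fixes u :: int
  assumes "prime q"
  shows "[u ^ q = u] (mod int q)"
proof -
  have q: "q > 0" using assms prime_gt_0_nat by blast
  define m where "m = nat (u mod int q)"
  have m: "[u = int m] (mod int q)"
    using q by (simp add: m_def cong_def)
  have "[m ^ q = m] (mod q)"
  proof (cases "q dvd m")
    case True
    then have "q dvd m ^ q" using q by (meson dvd_power dvd_trans)
    with True show ?thesis by (simp add: cong_def)
  next
    case False
    have "[m ^ (q - 1) * m = 1 * m] (mod q)"
      using fermat_theorem[OF assms False] by (rule cong_scalar_right)
    then show ?thesis using q by (simp del: One_nat_def add: power_minus_mult)
  qed
  then have "[int m ^ q = int m] (mod int q)"
    by (metis cong_int_iff of_nat_power)
  then show ?thesis
    using m by (meson cong_pow cong_sym cong_trans)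
qed

text \<open>Modulo \<open>q\<close>, Frobenius fixes the integer coefficients and sends
  \<open>omega\<close> to \<open>omega ^ (q ^ k)\<close>, which is \<open>omega\<close> again since
  \<open>q ^ k\<close> is 1 modulo 3. Primes \<open>q\<close> that are 1 modulo 3 are served by
  \<open>k = 1\<close>, those that are 2 modulo 3 by \<open>k = 2\<close>.\<close>

lemma eisenstein_fermat:
  assumes "prime q" "q ^ k mod 3 = 1" "z \<in> eisenstein"
  shows "eisenstein.scong (int q) (z ^ (q ^ k)) z"
proof -
  obtain a b where z: "z = of_int a + of_int b * omega"
    using assms(3) by (auto simp: eisenstein_def)
  have pow: "[u ^ (q ^ k) = u] (mod int q)" for u :: int
  proof (induction k)
    case (Suc k)
    have "[(u ^ (q ^ k)) ^ q = u ^ q] (mod int q)"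
      by (intro cong_pow Suc)
    also have "[u ^ q = u] (mod int q)"
      using fermat_int[OF assms(1)] .
    finally show ?case by (simp add: power_mult[symmetric] mult.commute)
  qed auto
  \<comment> \<open>The two terms of \<open>z\<close> become a sum over \<open>{..<2}\<close>, the
    form in which iterated Frobenius is stated.\<close>
  define f where "f = (\<lambda>i::nat. if i = 0 then of_int a else of_int b * omega)"
  have "eisenstein.scong (int q) ((\<Sum>i<2. f i) ^ (q ^ k)) (\<Sum>i<2. f i ^ (q ^ k))"
    using assms(1) by (rule eisenstein.scong_freshman)
      (auto simp: f_def intro: eisenstein.of_int_mem eisenstein.mult_mem omega_mem)
  moreover have "(\<Sum>i<2. f i) = z" "(\<Sum>i<2. f i ^ (q ^ k)) =
      of_int (a ^ (q ^ k)) + of_int (b ^ (q ^ k)) * omega ^ (q ^ k)"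
    by (simp_all add: f_def z numeral_2_eq_2 power_mult_distrib)
  moreover have "omega ^ (q ^ k) = omega"
    using omega_power_mod[of "q ^ k"] assms(2) by simp
  moreover have "eisenstein.scong (int q) (of_int (a ^ (q ^ k)) + of_int (b ^ (q ^ k)) * omega) z"
    unfolding z scong_eisenstein_iff using pow by blast
  ultimately show ?thesis
    using eisenstein.scong_trans by metis
qed

section \<open>Cubic Gauss and Jacobi sums\<close>

lemma bij_betw_mult_mod:
  assumes "coprime a p" "p > 0"
  shows "bij_betw (\<lambda>t. a * t mod p) {..<p} {..<p :: nat}"
proof -
  have inj: "inj_on (\<lambda>t. a * t mod p) {..<p}"
  proof (rule inj_onI)
    fix t u assume *: "t \<in> {..<p}" "u \<in> {..<p}" "a * t mod p = a * u mod p"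
    then have "[a * t = a * u] (mod p)" by (simp add: cong_def)
    then have "[t = u] (mod p)" using assms(1) cong_mult_lcancel_nat by blast
    with * show "t = u" by (simp add: cong_def)
  qed
  moreover have "(\<lambda>t. a * t mod p) ` {..<p} \<subseteq> {..<p}"
    using assms(2) by auto
  ultimately have "(\<lambda>t. a * t mod p) ` {..<p} = {..<p}"
    by (intro endo_inj_surj) auto
  with inj show ?thesis by (simp add: bij_betw_def)
qed

locale cubic_character =
  fixes p :: nat and \<chi> :: "nat \<Rightarrow> complex"
  assumes prime_p: "prime p" and p_neq_3: "p \<noteq> 3"
    and chi_mult: "\<chi> (a * b) = \<chi> a * \<chi> b"
    and chi_mod: "\<chi> (a mod p) = \<chi> a"
    and chi_eq_0: "p dvd a \<Longrightarrow> \<chi> a = 0"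
    and chi_range: "\<not> p dvd a \<Longrightarrow> \<exists>k<3. \<chi> a = omega ^ k"
    and chi_nontrivial: "\<exists>r. \<not> p dvd r \<and> \<chi> r \<noteq> 1"
begin

lemma p_gt_0: "p > 0"
  using prime_p prime_gt_0_nat by blast

lemma chi_0: "\<chi> 0 = 0"
  by (rule chi_eq_0) simp

lemma chi_cubed: "\<not> p dvd a \<Longrightarrow> \<chi> a ^ 3 = 1"
  by (metis chi_range omega_cubed power_mult mult.commute power_one)

lemma chi_power_mod: "n > 0 \<Longrightarrow> n mod 3 = 1 \<Longrightarrow> \<chi> a ^ n = \<chi> a"
proof (cases "p dvd a")
  case False
  assume "n mod 3 = 1"
  then obtain m where "n = 3 * m + 1" by (metis mult_div_mod_eq)
  then show ?thesis using chi_cubed[OF False] by (simp add: power_add power_mult)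
qed (simp add: chi_eq_0)

lemma cnj_chi_mult_chi: "\<not> p dvd a \<Longrightarrow> cnj (\<chi> a) * \<chi> a = 1"
proof -
  assume "\<not> p dvd a"
  have *: "cnj omega * omega = 1"
    by (simp add: cnj_omega omega_mult_omega algebra_simps)
  obtain k where "\<chi> a = omega ^ k" using chi_range \<open>\<not> p dvd a\<close> by blast
  then show ?thesis by (simp add: power_mult_distrib[symmetric] *)
qed

lemma cnj_chi_sq: "cnj (\<chi> a) ^ 2 = \<chi> a"
proof (cases "p dvd a")
  case False
  have "cnj (\<chi> a) ^ 2 = cnj (\<chi> a) ^ 2 * \<chi> a ^ 3"
    using chi_cubed[OF False] by simp
  also have "\<dots> = (cnj (\<chi> a) * \<chi> a) ^ 2 * \<chi> a"
    by (simp add: power2_eq_square power3_eq_cube)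
  finally show ?thesis using cnj_chi_mult_chi[OF False] by simp
qed (simp add: chi_eq_0)

lemma chi_mem: "\<chi> a \<in> eisenstein"
  using chi_range[of a] chi_eq_0[of a] eisenstein.zero_mem eisenstein.power_mem[OF omega_mem]
  by (cases "p dvd a") auto

lemma chi_1: "\<chi> 1 = 1"
proof -
  have "\<not> p dvd 1" using prime_p prime_gt_1_nat[of p] by auto
  then show ?thesis using chi_mult[of 1 1] cnj_chi_mult_chi[of 1] by auto
qed

text \<open>The number \<open>p - 1\<close> represents -1, so its character value has both square
  and cube equal to 1.\<close>

lemma chi_minus_1: "\<chi> (p - 1) = 1"
proof -
  have p: "p > 1" using prime_p prime_gt_1_nat by blast
  then have "\<not> p dvd (p - 1)" by (auto dest: dvd_imp_le)
  then have 3: "\<chi> (p - 1) ^ 3 = 1" by (rule chi_cubed)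
  have "(p - 1) * (p - 1) = p * (p - 2) + 1"
    using p by (cases p; cases "p - 1") (auto simp: algebra_simps)
  then have "(p - 1) * (p - 1) mod p = 1"
    using p by (metis mod_mult_self4 mod_less)
  then have "\<chi> (p - 1) * \<chi> (p - 1) = 1"
    by (metis chi_mult chi_mod chi_1)
  with 3 show ?thesis by (simp add: power3_eq_cube)
qed

lemma sum_reindex_mult:
  assumes "\<not> p dvd a" "\<And>t. f (t mod p) = f t"
  shows "(\<Sum>t<p. f (a * t)) = (\<Sum>t<p. f t)"
proof -
  have "coprime a p"
    using assms(1) prime_p prime_imp_coprime coprime_commute by blast
  then have "(\<Sum>t<p. f (a * t mod p)) = (\<Sum>t<p. f t)"
    using p_gt_0 by (intro sum.reindex_bij_betw bij_betw_mult_mod)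
  then show ?thesis by (simp add: assms(2))
qed

lemma sum_chi: "(\<Sum>t<p. \<chi> t) = 0"
proof -
  obtain r where r: "\<not> p dvd r" "\<chi> r \<noteq> 1" using chi_nontrivial by blast
  have "(\<Sum>t<p. \<chi> t) = (\<Sum>t<p. \<chi> (r * t))"
    using sum_reindex_mult[OF r(1), of \<chi>] chi_mod by simp
  also have "\<dots> = \<chi> r * (\<Sum>t<p. \<chi> t)"
    by (simp add: chi_mult sum_distrib_left)
  finally show ?thesis using r(2) by simp
qed

section \<open>Roots of unity, the trace and the Gauss sum\<close>

definition zeta :: complex where
  "zeta = cis (2 * pi / p)"

lemma zeta_power_p: "zeta ^ p = 1"
  using p_gt_0 by (simp add: zeta_def DeMoivre)

lemma zeta_power_mod: "zeta ^ (n mod p) = zeta ^ n"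
  by (metis (no_types) div_mult_mod_eq power_add power_mult zeta_power_p power_one mult_1 mult.commute)

lemma zeta_power_eq_1_iff: "zeta ^ n = 1 \<longleftrightarrow> p dvd n"
proof
  assume "zeta ^ n = 1"
  then have "zeta ^ (n mod p) = 1" by (simp add: zeta_power_mod)
  then have "cis (2 * pi * real (n mod p) / real p) = cis (2 * pi * real 0 / real p)"
    by (simp add: zeta_def DeMoivre mult.commute)
  moreover have "inj_on (\<lambda>k. cis (2 * pi * real k / real p)) {..<p}"
    using bij_betw_roots_unity[OF p_gt_0] by (simp add: bij_betw_def)
  ultimately have "n mod p = 0"
    using p_gt_0 inj_onD[of "\<lambda>k. cis (2 * pi * real k / real p)" "{..<p}" "n mod p" 0] by simp
  then show "p dvd n" by auto
next
  assume "p dvd n"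
  then show "zeta ^ n = 1" using zeta_power_p by (auto simp: power_mult)
qed

lemma cnj_zeta: "cnj zeta = zeta ^ (p - 1)"
proof -
  have "zeta ^ (p - 1) * zeta = 1"
    using power_minus_mult[OF p_gt_0, of zeta] zeta_power_p by simp
  moreover have "cnj zeta * zeta = 1"
    by (simp add: zeta_def cis_cnj cis_mult)
  moreover have "zeta \<noteq> 0" by (simp add: zeta_def)
  ultimately show ?thesis by (metis mult_right_cancel)
qed

lemma sum_zeta_powers: "(\<Sum>j<p. (zeta ^ k) ^ j) = (if p dvd k then of_nat p else 0)"
proof (cases "p dvd k")
  case False
  then have "zeta ^ k \<noteq> 1" by (simp add: zeta_power_eq_1_iff)
  moreover have "(zeta ^ k) ^ p = 1"
    by (metis power_mult mult.commute zeta_power_p power_one)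
  ultimately show ?thesis using False
    by (simp add: geometric_sum)
qed (simp add: zeta_power_eq_1_iff[THEN iffD2])

text \<open>On a polynomial \<open>P\<close>, this takes the sum of the coefficients at exponents congruent to 1
  modulo \<open>p\<close>, which makes divisibility of its values visible without the ring of integers of
  the cyclotomic field.\<close>

definition trace1 :: "complex poly \<Rightarrow> complex" where
  "trace1 P = (\<Sum>j<p. cnj zeta ^ j * poly P (zeta ^ j)) / of_nat p"

lemma trace1_add: "trace1 (P + Q) = trace1 P + trace1 Q"
  by (simp add: trace1_def algebra_simps sum.distrib add_divide_distrib)

lemma trace1_0: "trace1 0 = 0"
  by (simp add: trace1_def)

lemma trace1_sum: "trace1 (\<Sum>i\<in>A. f i) = (\<Sum>i\<in>A. trace1 (f i))"
  by (induction A rule: infinite_finite_induct) (auto simp: trace1_add trace1_0)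

lemma trace1_smult: "trace1 (smult c P) = c * trace1 P"
  by (simp add: trace1_def sum_distrib_left mult_ac)

text \<open>Orthogonality of the \<open>p\<close>-th roots of unity; the exponent
  \<open>p - 1 + k\<close> stands for \<open>k - 1\<close>, because conjugating \<open>zeta\<close>
  raises it to the power \<open>p - 1\<close>.\<close>

lemma trace1_monom: "trace1 (monom c k) = (if [k = 1] (mod p) then c else 0)"
proof -
  have "cnj zeta ^ j * poly (monom c k) (zeta ^ j) = c * (zeta ^ (p - 1 + k)) ^ j" for j
    by (simp add: cnj_zeta poly_monom power_mult[symmetric] power_add[symmetric] algebra_simps del: One_nat_def)
  then have "trace1 (monom c k) = c * (\<Sum>j<p. (zeta ^ (p - 1 + k)) ^ j) / of_nat p"
    by (simp add: trace1_def sum_distrib_left)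
  also have "p dvd (p - 1 + k) \<longleftrightarrow> [k = 1] (mod p)"
  proof -
    have "p dvd (p - 1 + k) \<longleftrightarrow> [p - 1 + k = p - 1 + 1] (mod p)"
      using p_gt_0 by (simp add: cong_0_iff[symmetric] cong_def)
    then show ?thesis by (simp only: cong_add_lcancel_nat)
  qed
  ultimately show ?thesis using p_gt_0 by (simp add: sum_zeta_powers)
qed

lemma trace1_mem:
  assumes "\<forall>i. coeff P i \<in> eisenstein"
  shows "trace1 P \<in> eisenstein"
proof -
  have "trace1 P = (\<Sum>i\<le>degree P. trace1 (monom (coeff P i) i))"
    by (metis trace1_sum poly_as_sum_of_monoms)
  also have "\<dots> \<in> eisenstein"
    using assms by (intro eisenstein.sum_mem) (auto simp: trace1_monom eisenstein.zero_mem)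
  finally show ?thesis .
qed

text \<open>The Gauss sum with the root of unity replaced by an indeterminate, so that congruences
  can be read coefficientwise; \<open>g\<close> is the classical Gauss sum.\<close>

definition G :: "complex poly" where
  "G = (\<Sum>t<p. monom (\<chi> t) t)"

definition g :: complex where
  "g = poly G zeta"

lemma poly_G: "poly G z = (\<Sum>t<p. \<chi> t * z ^ t)"
  by (simp add: G_def poly_sum poly_monom)

lemma coeff_G_mem: "coeff G i \<in> eisenstein"
  by (auto simp: G_def coeff_sum intro!: eisenstein.sum_mem chi_mem eisenstein.zero_mem)

text \<open>Substituting \<open>j * t\<close> for \<open>t\<close> extracts the factor
  \<open>\<chi> j\<close>. When \<open>p\<close> divides \<open>j\<close>, the left side is the full
  character sum, which vanishes.\<close>

lemma poly_G_zeta_power: "poly G (zeta ^ j) = cnj (\<chi> j) * g"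
proof (cases "p dvd j")
  case True
  then show ?thesis
    using zeta_power_eq_1_iff[of j] by (simp add: poly_G sum_chi chi_eq_0)
next
  case False
  have "\<chi> j * poly G (zeta ^ j) = (\<Sum>t<p. \<chi> (j * t) * zeta ^ (j * t))"
    by (simp add: poly_G sum_distrib_left chi_mult power_mult[symmetric] mult_ac)
  also have "\<dots> = g"
    unfolding g_def poly_G
    by (rule sum_reindex_mult[OF False, of "\<lambda>t. \<chi> t * zeta ^ t"]) (simp add: chi_mod zeta_power_mod)
  finally have "cnj (\<chi> j) * (\<chi> j * poly G (zeta ^ j)) = cnj (\<chi> j) * g" by simp
  then show ?thesis using cnj_chi_mult_chi[OF False]
    by (simp add: mult.assoc[symmetric])
qed

lemma trace1_G_power:
  "trace1 (G ^ n) = g ^ n / of_nat p * (\<Sum>j<p. cnj zeta ^ j * cnj (\<chi> j) ^ n)"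
  by (simp add: trace1_def poly_G_zeta_power power_mult_distrib sum_distrib_left sum_divide_distrib mult_ac)

lemma trace1_G: "trace1 G = 1"
proof -
  have p: "p > 1" using prime_p prime_gt_1_nat by blast
  have "trace1 G = (\<Sum>t<p. if t = 1 then \<chi> t else 0)"
    unfolding G_def trace1_sum trace1_monom using p
    by (intro sum.cong) (auto simp: cong_def)
  also have "\<dots> = 1" using p chi_1 by (simp add: sum.delta)
  finally show ?thesis .
qed

lemma cnj_g: "cnj g = (\<Sum>j<p. cnj zeta ^ j * cnj (\<chi> j))"
  by (simp add: g_def poly_G mult.commute)

text \<open>Two evaluations of the trace of \<open>G\<close> are compared: its coefficient at
  exponent 1 is \<open>\<chi> 1 = 1\<close>, and its values at the roots of unity give
  \<open>g * cnj g / p\<close>.\<close>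

lemma g_mult_cnj: "g * cnj g = of_nat p"
  using trace1_G_power[of 1] trace1_G p_gt_0 by (simp add: cnj_g[symmetric] divide_simps)

text \<open>For such \<open>n\<close> the \<open>n\<close>-th powers of character values are the
  values themselves, so the remaining sum is \<open>cnj g\<close>. As 3 divides
  \<open>n - 1\<close>, the result is a power of \<open>g ^ 3 = p * J\<close>.\<close>

lemma trace1_G_power_mod:
  assumes "n mod 3 = 1"
  shows "trace1 (G ^ n) = g ^ (n - 1)"
proof -
  have "n > 0" using assms by (cases n) auto
  have "cnj (\<chi> j) ^ n = cnj (\<chi> j)" for j
    using chi_power_mod[OF \<open>n > 0\<close> assms, of j] by (metis complex_cnj_power)
  then have "trace1 (G ^ n) = g ^ n * cnj g / of_nat p"
    by (simp add: trace1_G_power cnj_g)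
  also have "g ^ n = g ^ (n - 1) * g"
    using \<open>n > 0\<close> power_minus_mult by metis
  also have "g ^ (n - 1) * g * cnj g / of_nat p = g ^ (n - 1)"
    using p_gt_0 by (simp add: mult.assoc g_mult_cnj)
  finally show ?thesis .
qed

text \<open>The Jacobi sum of the character with itself, since the square of \<open>g\<close>
  divided by the Gauss sum of the conjugate character is \<open>g ^ 3 / p\<close>. Its integrality
  comes from the next lemma.\<close>

definition J :: complex where
  "J = g ^ 3 / of_nat p"

text \<open>Squaring a conjugated character value undoes the conjugation, so the sum is
  \<open>G\<close> at the inverse of \<open>zeta\<close>, which is \<open>g\<close> because the
  character is 1 at -1.\<close>

lemma trace1_G_sq: "trace1 (G ^ 2) = J"
proof -
  have "(\<Sum>j<p. cnj zeta ^ j * cnj (\<chi> j) ^ 2) = poly G (zeta ^ (p - 1))"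
    by (simp add: cnj_chi_sq poly_G cnj_zeta mult.commute)
  also have "\<dots> = g"
    by (simp add: poly_G_zeta_power chi_minus_1 del: One_nat_def)
  finally show ?thesis
    unfolding trace1_G_power J_def power2_eq_square[of g] power3_eq_cube by simp
qed

lemma J_mem: "J \<in> eisenstein"
proof -
  interpret polys: comm_subring "{P. \<forall>i. coeff P i \<in> eisenstein}"
    by (rule comm_subring_polys) (rule eisenstein.comm_subring_axioms)
  have "G ^ 2 \<in> {P. \<forall>i. coeff P i \<in> eisenstein}"
    by (intro polys.power_mem CollectI allI coeff_G_mem)
  then show ?thesis
    using trace1_mem[of "G ^ 2"] unfolding trace1_G_sq by blast
qed

lemma J_mult_cnj: "J * cnj J = of_nat p"
proof -
  have "J * cnj J = (g * cnj g) ^ 3 / (of_nat p * of_nat p)"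
    by (simp only: J_def power_mult_distrib complex_cnj_divide complex_cnj_power
        complex_cnj_of_nat times_divide_times_eq)
  also have "\<dots> = of_nat p"
    using p_gt_0 by (simp only: g_mult_cnj power3_eq_cube) simp
  finally show ?thesis .
qed

text \<open>The cubes of the character values are all 1 except for \<open>\<chi> 0 = 0\<close>, so
  what is left is a complete sum of roots of unity without its term at \<open>j = 0\<close>, that is
  -1. This serves to determine \<open>J\<close> modulo 3.\<close>

lemma trace1_G_cubed: "trace1 (G ^ 3) = - J"
proof -
  have "(\<Sum>j<p. cnj zeta ^ j * cnj (\<chi> j) ^ 3) = (\<Sum>j<p. (zeta ^ (p - 1)) ^ j - (if j = 0 then 1 else 0))"
  proof (intro sum.cong refl)
    fix j assume j: "j \<in> {..<p}"
    show "cnj zeta ^ j * cnj (\<chi> j) ^ 3 = (zeta ^ (p - 1)) ^ j - (if j = 0 then 1 else 0)"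
    proof (cases "j = 0")
      case False
      then have "\<chi> j ^ 3 = 1" using j by (intro chi_cubed) (auto dest: dvd_imp_le)
      then have "cnj (\<chi> j) ^ 3 = 1" by (metis complex_cnj_power complex_cnj_one)
      then show ?thesis using False by (simp add: cnj_zeta)
    qed (simp add: chi_0)
  qed
  also have "\<dots> = (\<Sum>j<p. (zeta ^ (p - 1)) ^ j) - 1"
    using p_gt_0 by (simp add: sum_subtractf)
  also have "\<not> p dvd (p - 1)"
    using prime_p prime_gt_1_nat[of p] by (auto dest: dvd_imp_le)
  then have "(\<Sum>j<p. (zeta ^ (p - 1)) ^ j) - 1 = -1"
    by (simp add: sum_zeta_powers)
  finally show ?thesis by (simp add: trace1_G_power J_def)
qed

text \<open>Modulo \<open>q\<close> the power of \<open>G\<close> has only the terms of exponent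
  \<open>u * q ^ k\<close>, and the trace keeps the one with \<open>u\<close> congruent to
  \<open>t\<close>. Together with \<open>trace1_G_power_mod\<close> this evaluates the same trace
  twice, which is the source of the reciprocity law.\<close>

lemma trace1_G_freshman:
  assumes "prime q" "[q ^ k * t = 1] (mod p)"
  shows "eisenstein.scong (int q) (trace1 (G ^ (q ^ k))) (\<chi> t ^ (q ^ k))"
proof -
  define n where "n = q ^ k"
  interpret polys: comm_subring "{P. \<forall>i. coeff P i \<in> eisenstein}"
    by (rule comm_subring_polys) (rule eisenstein.comm_subring_axioms)
  have "polys.scong (int q) (G ^ n) (\<Sum>t<p. monom (\<chi> t) t ^ n)"
    unfolding G_def n_def using assms(1)
    by (intro polys.scong_freshman) (auto simp: chi_mem eisenstein.zero_mem)
  then obtain H where H: "\<forall>i. coeff H i \<in> eisenstein"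
    and "G ^ n - (\<Sum>t<p. monom (\<chi> t) t ^ n) = of_int (int q) * H"
    by (auto simp: polys.scong_def)
  then have "G ^ n = (\<Sum>t<p. monom (\<chi> t ^ n) (t * n)) + smult (of_nat q) H"
    by (simp add: monom_power algebra_simps of_nat_poly)
  then have "trace1 (G ^ n) = (\<Sum>u<p. if [u * n = 1] (mod p) then \<chi> u ^ n else 0) + of_nat q * trace1 H"
    by (simp add: trace1_add trace1_sum trace1_monom trace1_smult)
  also have "(\<Sum>u<p. if [u * n = 1] (mod p) then \<chi> u ^ n else 0) =
      (\<Sum>u<p. if u = t mod p then \<chi> t ^ n else 0)"
  proof (intro sum.cong refl)
    fix u assume u: "u \<in> {..<p}"
    have cop: "coprime n p"
      using assms(2) by (metis coprime_iff_invertible_nat n_def One_nat_def)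
    have "[u * n = 1] (mod p) \<longleftrightarrow> [n * u = n * t] (mod p)"
      using assms(2) unfolding n_def by (metis cong_sym cong_trans mult.commute)
    also have "\<dots> \<longleftrightarrow> u = t mod p"
      using u by (simp add: cong_mult_lcancel_nat[OF cop]) (simp add: cong_def)
    finally show "(if [u * n = 1] (mod p) then \<chi> u ^ n else 0) = (if u = t mod p then \<chi> t ^ n else 0)"
      using chi_mod by simp
  qed
  also have "\<dots> = \<chi> t ^ n" using p_gt_0 by simp
  finally show ?thesis
    using trace1_mem[OF H] unfolding eisenstein.scong_def n_def by auto
qed

end

section \<open>The cubic polynomial\<close>

definition cform :: "int \<Rightarrow> int \<Rightarrow> int \<Rightarrow> int" where
  "cform a m x = m * (x ^ 3 - 3 * x ^ 2 + 1) + a * (x ^ 2 - x)"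

text \<open>Dividing the form by \<open>x ^ 2 - x + 1\<close>, the norm of \<open>x + omega\<close>,
  leaves the remainder \<open>-(a + 3 * m * (x - 1))\<close>; this in turn divides the target up to
  a multiple of \<open>x ^ 2 - x + 1\<close>. With the target equal to \<open>p\<close>, a prime
  other than \<open>p\<close> dividing a value cannot divide the norm.\<close>

lemma dvd_norm_if_dvd_cform:
  fixes q :: int
  assumes "q dvd cform a m x" "q dvd x ^ 2 - x + 1"
  shows "q dvd a ^ 2 - 3 * a * m + 9 * m ^ 2"
proof -
  have "a + 3 * m * (x - 1) = (m * (x - 2) + a) * (x ^ 2 - x + 1) - cform a m x"
    by (simp add: cform_def power2_eq_square power3_eq_cube algebra_simps)
  then have 1: "q dvd a + 3 * m * (x - 1)"
    using assms by (metis dvd_diff dvd_mult)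
  have "a ^ 2 - 3 * a * m + 9 * m ^ 2 =
      (a + 3 * m * (x - 1)) * (a - 3 * m * x) + 9 * m ^ 2 * (x ^ 2 - x + 1)"
    by (simp add: power2_eq_square algebra_simps)
  then show ?thesis using 1 assms(2) by (metis dvd_add dvd_mult dvd_mult2)
qed

text \<open>Four times the norm of \<open>J * (x + omega) ^ 3 = A + 3 * F * omega\<close>, with the
  square completed as \<open>(2 * A - 3 * F) ^ 2 + 27 * F ^ 2\<close>.\<close>

lemma cform_norm:
  "27 * cform a m x ^ 2 + (2 * a * (x ^ 3 - 3 * x + 1) - 18 * m * (x ^ 2 - x) - 3 * cform a m x) ^ 2 =
     4 * (a ^ 2 - 3 * a * m + 9 * m ^ 2) * (x ^ 2 - x + 1) ^ 3"
  unfolding cform_def by (simp add: power2_eq_square power3_eq_cube algebra_simps)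

text \<open>Values at \<open>x\<close> and \<open>y\<close> are two linear equations for
  \<open>m\<close> and \<open>a\<close>; their determinant is, up to sign,
  \<open>(y - x) * cform_gap x y\<close>.\<close>

definition cform_gap :: "int \<Rightarrow> int \<Rightarrow> int" where
  "cform_gap x y = x ^ 2 * y ^ 2 - x * y * (x + y) + 3 * x * y - (x + y) + 1"

lemma cform_elim_a:
  "cform a m y * (x ^ 2 - x) - cform a m x * (y ^ 2 - y) = m * ((y - x) * cform_gap x y)"
  unfolding cform_def cform_gap_def by (simp add: power2_eq_square power3_eq_cube algebra_simps)

lemma cform_elim_m:
  "cform a m x * (y ^ 3 - 3 * y ^ 2 + 1) - cform a m y * (x ^ 3 - 3 * x ^ 2 + 1) = a * ((y - x) * cform_gap x y)"
  unfolding cform_def cform_gap_def by (simp add: power2_eq_square power3_eq_cube algebra_simps)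

section \<open>Roots, lifting and size of the values when the norm of the coefficients is a
  prime\<close>

context
  fixes p a m :: int
  assumes prime_p: "prime p" and p_eq: "p = a ^ 2 - 3 * a * m + 9 * m ^ 2"
begin

text \<open>A common prime factor would enter the norm \<open>p\<close> with its square.\<close>

lemma not_dvd_both:
  assumes "prime q" "q dvd a"
  shows "\<not> q dvd m"
proof
  assume "q dvd m"
  then obtain u v where "a = q * u" "m = q * v" using assms(2) by (auto elim!: dvdE)
  then have p: "p = q * (q * (u ^ 2 - 3 * u * v + 9 * v ^ 2))"
    by (simp add: p_eq power2_eq_square algebra_simps)
  then have "is_unit q \<or> is_unit (q * (u ^ 2 - 3 * u * v + 9 * v ^ 2))"
    using prime_p prime_elem_imp_irreducible[of p] irreducibleD by blast
  then show False using assms(1) not_prime_unit by (meson dvd_mult_left)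
qed

lemma coprime_coeffs: "coprime a m"
proof (rule coprimeI)
  fix d assume d: "d dvd a" "d dvd m"
  show "is_unit d"
  proof (rule ccontr)
    assume "\<not> is_unit d"
    moreover have "d \<noteq> 0"
      using d prime_p p_eq by auto
    ultimately obtain q where "prime q" "q dvd d"
      using prime_divisor_exists by blast
    then show False using d not_dvd_both dvd_trans by blast
  qed
qed

text \<open>In the norm equation with right side \<open>p * (x ^ 2 - x + 1) ^ 3\<close>,
  divisibility of the value by \<open>p\<close> forces \<open>p\<close> to divide \<open>A\<close>
  as well. Then the square of \<open>p\<close> divides the left side, so \<open>p\<close> divides
  \<open>x ^ 2 - x + 1\<close>, which is too small.\<close>

lemma not_p_dvd_cform:
  assumes "0 < x ^ 2 - x + 1" "x ^ 2 - x + 1 < p"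
  shows "\<not> p dvd cform a m x"
proof
  assume F: "p dvd cform a m x"
  define A where "A = a * (x ^ 3 - 3 * x + 1) - 9 * m * (x ^ 2 - x)"
  have id: "A ^ 2 - 3 * A * cform a m x + 9 * cform a m x ^ 2 = p * (x ^ 2 - x + 1) ^ 3"
    unfolding A_def cform_def p_eq by (simp add: power2_eq_square power3_eq_cube algebra_simps)
  have "A ^ 2 = (A ^ 2 - 3 * A * cform a m x + 9 * cform a m x ^ 2) - cform a m x * (9 * cform a m x - 3 * A)"
    by (simp add: power2_eq_square algebra_simps)
  then have "A ^ 2 = p * (x ^ 2 - x + 1) ^ 3 - cform a m x * (9 * cform a m x - 3 * A)"
    by (simp only: id)
  then have "p dvd A ^ 2" using F by (metis dvd_diff dvd_mult2 dvd_triv_left)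
  then have "p dvd A" using prime_p prime_dvd_power by blast
  then obtain u v where "A = p * u" "cform a m x = p * v" using F by (auto elim!: dvdE)
  then have "A ^ 2 - 3 * A * cform a m x + 9 * cform a m x ^ 2 = p * (p * (u ^ 2 - 3 * u * v + 9 * v ^ 2))"
    by (simp add: power2_eq_square algebra_simps)
  then have "p * (x ^ 2 - x + 1) ^ 3 = p * (p * (u ^ 2 - 3 * u * v + 9 * v ^ 2))"
    by (simp only: id)
  then have "(x ^ 2 - x + 1) ^ 3 = p * (u ^ 2 - 3 * u * v + 9 * v ^ 2)"
    using prime_p by auto
  then have "p dvd (x ^ 2 - x + 1) ^ 3" by simp
  then have "p dvd x ^ 2 - x + 1" using prime_p prime_dvd_power by blast
  then show False using assms zdvd_imp_le by fastforce
qed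

text \<open>Uniqueness of Hensel lifting. For \<open>x\<close> and \<open>y\<close> congruent modulo
  \<open>q\<close> the gap is congruent to \<open>(x ^ 2 - x + 1) ^ 2\<close>, hence prime to
  \<open>q\<close>; elimination then makes \<open>q ^ k\<close> divide both
  \<open>m * (y - x)\<close> and \<open>a * (y - x)\<close>, and \<open>a\<close> and
  \<open>m\<close> are coprime.\<close>

lemma cform_lift:
  assumes q: "prime q" "q \<noteq> p" and "q dvd cform a m x" "q dvd x - y"
    and k: "q ^ k dvd cform a m x" "q ^ k dvd cform a m y"
  shows "q ^ k dvd x - y"
proof -
  have "\<not> q dvd p" using q prime_p primes_dvd_imp_eq by blast
  then have N: "\<not> q dvd x ^ 2 - x + 1"
    using dvd_norm_if_dvd_cform[OF assms(3)] p_eq by metis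
  have "\<not> q dvd cform_gap x y"
  proof
    assume *: "q dvd cform_gap x y"
    have "(x ^ 2 - x + 1) ^ 2 = cform_gap x y + (x - y) * (x ^ 2 * (x + y) - x * (2 * x + y) + 3 * x - 1)"
      unfolding cform_gap_def by (simp add: power2_eq_square power3_eq_cube algebra_simps)
    then have "q dvd (x ^ 2 - x + 1) ^ 2" using * assms(4) by simp
    then show False using N q(1) prime_dvd_power by blast
  qed
  then have cop: "coprime (q ^ k) (cform_gap x y)"
    using q(1) by (simp add: prime_imp_coprime)
  have "q ^ k dvd m * ((y - x) * cform_gap x y)"
    unfolding cform_elim_a[of a m y x, symmetric] using k by (intro dvd_diff dvd_mult2)
  moreover have "q ^ k dvd a * ((y - x) * cform_gap x y)"
    unfolding cform_elim_m[of a m x y, symmetric] using k by (intro dvd_diff dvd_mult2)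
  ultimately have "q ^ k dvd (m * (y - x)) * cform_gap x y" "q ^ k dvd (a * (y - x)) * cform_gap x y"
    by (simp_all only: mult.assoc)
  then have dvds: "q ^ k dvd m * (y - x)" "q ^ k dvd a * (y - x)"
    using cop by (simp_all only: coprime_dvd_mult_left_iff)
  obtain u v where "u * a + v * m = 1"
    using coprime_coeffs by (metis bezout_int coprime_imp_gcd_eq_1)
  then have "(u * a + v * m) * (y - x) = y - x" by simp
  then have "y - x = u * (a * (y - x)) + v * (m * (y - x))" by (simp add: algebra_simps)
  then have "q ^ k dvd y - x" using dvds by (metis dvd_add dvd_mult)
  then show ?thesis by (simp add: dvd_diff_commute)
qed

text \<open>A cubic that is nonzero modulo a prime has at most three roots. Divided differences at
  four incongruent zeros would make \<open>q\<close> divide \<open>m\<close>, the third difference,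
  and then also \<open>a\<close>.\<close>

lemma card_roots_cform:
  assumes q: "prime q" and "finite I"
  shows "card ((\<lambda>x. x mod q) ` {x \<in> I. q dvd cform a m x}) \<le> 3"
proof (rule ccontr)
  assume "\<not> ?thesis"
  then have "card ((\<lambda>x. x mod q) ` {x \<in> I. q dvd cform a m x}) \<ge> 4" by simp
  then obtain T where "T \<subseteq> (\<lambda>x. x mod q) ` {x \<in> I. q dvd cform a m x}" and T: "card T = 4"
    by (rule obtain_subset_with_card_n)
  then obtain S where S: "S \<subseteq> {x \<in> I. q dvd cform a m x}" "inj_on (\<lambda>x. x mod q) S" "T = (\<lambda>x. x mod q) ` S"
    unfolding subset_image_inj by blast
  then have "card S = Suc (Suc (Suc (Suc 0)))"
    using T by (simp add: card_image)
  then obtain x1 x2 x3 x4 where S4: "S = {x1, x2, x3, x4}" and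
    distinct: "x1 \<noteq> x2" "x1 \<noteq> x3" "x1 \<noteq> x4" "x2 \<noteq> x3" "x2 \<noteq> x4" "x3 \<noteq> x4"
    by (auto simp: card_Suc_eq)
  have nd: "\<not> q dvd x - y" if "x \<in> S" "y \<in> S" "x \<noteq> y" for x y
    using that S(2) by (metis inj_onD mod_eq_dvd_iff)
  have cancel: "q dvd c" if "q dvd (x - y) * c" "x \<in> S" "y \<in> S" "x \<noteq> y" for x y c
    using that nd q prime_dvd_multD by blast
  have dvd: "q dvd cform a m x" if "x \<in> S" for x using that S(1) by auto
  \<comment> \<open>The first divided difference; \<open>D2\<close> below is the second.\<close>
  define D where "D = (\<lambda>x y. m * (x ^ 2 + x * y + y ^ 2) + (a - 3 * m) * (x + y) - a)"
  have D: "q dvd D x y" if "x \<in> S" "y \<in> S" "x \<noteq> y" for x y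
  proof -
    have "(x - y) * D x y = cform a m x - cform a m y"
      unfolding D_def cform_def by (simp add: power2_eq_square power3_eq_cube algebra_simps)
    then have "q dvd (x - y) * D x y" using that dvd by (metis dvd_diff)
    then show ?thesis using cancel that by blast
  qed
  define D2 where "D2 = (\<lambda>x y z. m * (x + y + z) + (a - 3 * m))"
  have D2: "q dvd D2 x y z" if "x \<in> S" "y \<in> S" "z \<in> S" "x \<noteq> y" "x \<noteq> z" "y \<noteq> z" for x y z
  proof -
    have "(y - z) * D2 x y z = D x y - D x z"
      unfolding D_def D2_def by (simp add: power2_eq_square power3_eq_cube algebra_simps)
    then have "q dvd (y - z) * D2 x y z" using that D by (metis dvd_diff)
    then show ?thesis using cancel that by blast
  qed
  have "(x3 - x4) * m = D2 x1 x2 x3 - D2 x1 x2 x4"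
    unfolding D2_def by (simp add: power2_eq_square power3_eq_cube algebra_simps)
  then have "q dvd (x3 - x4) * m" using D2 S4 distinct by (metis dvd_diff insertCI)
  then have qm: "q dvd m" using cancel S4 distinct by blast
  have "a = D2 x1 x2 x3 - m * (x1 + x2 + x3 - 3)"
    unfolding D2_def by (simp add: power2_eq_square power3_eq_cube algebra_simps)
  then have "q dvd a" using D2 S4 distinct qm by (metis dvd_diff insertCI dvd_mult2)
  then show False using not_dvd_both q qm by blast
qed

text \<open>One square is dropped from \<open>cform_norm\<close>, and \<open>x ^ 2 - x + 1\<close>
  is at most \<open>x ^ 2\<close>.\<close>

lemma cform_upper:
  assumes "x \<ge> 1"
  shows "27 * cform a m x ^ 2 \<le> 4 * p * x ^ 6"
proof -
  have "27 * cform a m x ^ 2 \<le> 4 * p * (x ^ 2 - x + 1) ^ 3"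
    using cform_norm[of a m x] zero_le_power2[of "2 * a * (x ^ 3 - 3 * x + 1) - 18 * m * (x ^ 2 - x) - 3 * cform a m x"]
    unfolding p_eq by linarith
  also have "(x ^ 2 - x + 1) ^ 3 \<le> (x ^ 2) ^ 3"
    using assms by (intro power_mono) (auto simp: power2_eq_square)
  finally show ?thesis using prime_p prime_gt_0_int[of p]
    by (simp add: power_mult[symmetric] mult_left_mono)
qed

text \<open>The coefficients \<open>a\<close> and \<open>m\<close>, and hence \<open>p\<close>, can be recovered from two values of the
  polynomial, so two values cannot both be small.\<close>

lemma cform_lower:
  assumes "2 \<le> x" "x \<le> n" "2 \<le> y" "y \<le> n"
  shows "sqrt p * \<bar>real_of_int (x - y)\<bar> \<le>
    (real_of_int n + 3) * (\<bar>cform a m x\<bar> / (x ^ 2 - x) + \<bar>cform a m y\<bar> / (y ^ 2 - y))"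
proof (cases "x = y")
  case True
  have "real_of_int x ^ 2 - x \<ge> 0" using assms by (simp add: power2_eq_square)
  then show ?thesis using True assms by auto
next
  case False
  \<comment> \<open>The functions \<open>d\<close> and \<open>c\<close> are the coefficients of
    \<open>a\<close> and \<open>m\<close> in the form.\<close>
  define d where "d = (\<lambda>x::int. x ^ 2 - x)"
  define c where "c = (\<lambda>x::int. x ^ 3 - 3 * x ^ 2 + 1)"
  have d0: "d z > 0" if "z \<ge> 2" for z using that by (simp add: d_def power2_eq_square)
  have gap: "cform_gap x y \<ge> d x * d y"
  proof -
    have "cform_gap x y - d x * d y = x * (y - 1) + y * (x - 1) + 1"
      unfolding cform_gap_def d_def by (simp add: power2_eq_square power3_eq_cube algebra_simps)
    moreover have "x * (y - 1) \<ge> 0" "y * (x - 1) \<ge> 0" using assms by simp_all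
    ultimately show ?thesis by linarith
  qed
  \<comment> \<open>Dividing \<open>c z\<close> by \<open>d z\<close> gives quotient
    \<open>z - 2\<close> and remainder \<open>-(2 * z - 1)\<close>, which is at most
    \<open>2 * d z\<close> in size; hence the bound \<open>z * d z\<close>.\<close>
  have cd: "\<bar>c z\<bar> \<le> n * d z" if "2 \<le> z" "z \<le> n" for z
  proof -
    have "c z = d z * (z - 2) - (2 * z - 1)" unfolding c_def d_def by (simp add: power2_eq_square power3_eq_cube algebra_simps)
    moreover have "2 * z - 1 \<le> 2 * d z"
    proof -
      have "2 * d z = 2 * z - 2 + 2 * (z - 1) * (z - 1)" unfolding d_def by (simp add: power2_eq_square power3_eq_cube algebra_simps)
      moreover have "(z - 1) * (z - 1) \<ge> 1 * 1" using that by (intro mult_mono) auto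
      ultimately show ?thesis by linarith
    qed
    moreover have "d z * (z - 2) \<ge> 0" using that d0[of z] by simp
    moreover have "d z * (z - 2) + 2 * d z \<le> n * d z"
      using that d0[of z] by (simp add: algebra_simps mult_left_mono)
    ultimately show ?thesis using that by linarith
  qed
  define h where "h = (\<lambda>z. \<bar>cform a m z\<bar> / real_of_int (d z))"
  define S where "S = h x + h y"
  define t where "t = \<bar>real_of_int (y - x)\<bar>"
  have h0: "h z \<ge> 0" if "z \<ge> 2" for z using d0[OF that] by (simp add: h_def)
  have Fh: "real_of_int \<bar>cform a m z\<bar> = h z * d z" if "z \<ge> 2" for z using d0[OF that] by (simp add: h_def)
  have dd: "real_of_int (d x * d y) > 0" using d0 assms by simp
  have abs_d: "\<bar>d x\<bar> = d x" "\<bar>d y\<bar> = d y" using d0[of x] d0[of y] assms by simp_all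
  have scale: "real_of_int (\<bar>z\<bar> * \<bar>y - x\<bar> * (d x * d y)) = (\<bar>real_of_int z\<bar> * t) * (d x * d y)" for z
    by (simp add: t_def)
  have gap': "\<bar>z\<bar> * \<bar>y - x\<bar> * (d x * d y) \<le> \<bar>z * ((y - x) * cform_gap x y)\<bar>" for z
  proof -
    have "\<bar>z\<bar> * \<bar>y - x\<bar> * (d x * d y) \<le> \<bar>z\<bar> * \<bar>y - x\<bar> * \<bar>cform_gap x y\<bar>"
      using gap by (intro mult_left_mono) auto
    then show ?thesis by (simp only: abs_mult mult.assoc)
  qed
  have m: "\<bar>real_of_int m\<bar> * t \<le> S"
  proof -
    note gap'[of m]
    also have "\<bar>m * ((y - x) * cform_gap x y)\<bar> = \<bar>cform a m y * d x - cform a m x * d y\<bar>"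
      by (simp only: cform_elim_a d_def)
    also have "\<dots> \<le> \<bar>cform a m y * d x\<bar> + \<bar>cform a m x * d y\<bar>"
      by (rule abs_triangle_ineq4)
    finally have "real_of_int (\<bar>m\<bar> * \<bar>y - x\<bar> * (d x * d y)) \<le> real_of_int (\<bar>cform a m y\<bar> * d x + \<bar>cform a m x\<bar> * d y)"
      by (simp only: of_int_le_iff abs_mult abs_d)
    also have "\<dots> = S * (d x * d y)"
      by (simp only: of_int_add of_int_mult Fh[OF assms(1)] Fh[OF assms(3)] S_def algebra_simps)
    finally show ?thesis unfolding scale using dd by (rule mult_right_le_imp_le)
  qed
  have a: "\<bar>real_of_int a\<bar> * t \<le> n * S"
  proof -
    note gap'[of a]
    also have "\<bar>a * ((y - x) * cform_gap x y)\<bar> = \<bar>cform a m x * c y - cform a m y * c x\<bar>"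
      by (simp only: cform_elim_m c_def)
    also have "\<dots> \<le> \<bar>cform a m x * c y\<bar> + \<bar>cform a m y * c x\<bar>"
      by (rule abs_triangle_ineq4)
    also have "\<dots> \<le> \<bar>cform a m x\<bar> * (n * d y) + \<bar>cform a m y\<bar> * (n * d x)"
      unfolding abs_mult using cd assms by (intro add_mono mult_left_mono) auto
    finally have "real_of_int (\<bar>a\<bar> * \<bar>y - x\<bar> * (d x * d y)) \<le> real_of_int (\<bar>cform a m x\<bar> * (n * d y) + \<bar>cform a m y\<bar> * (n * d x))"
      by (simp only: of_int_le_iff)
    also have "\<dots> = (n * S) * (d x * d y)"
      by (simp only: of_int_add of_int_mult Fh[OF assms(1)] Fh[OF assms(3)] S_def algebra_simps)
    finally show ?thesis unfolding scale using dd by (rule mult_right_le_imp_le)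
  qed
  define \<mu> where "\<mu> = \<bar>real_of_int m\<bar> * t"
  define \<nu> where "\<nu> = \<bar>real_of_int a\<bar> * t"
  have S0: "S \<ge> 0" using h0 assms by (simp add: S_def)
  have pos: "\<mu> \<ge> 0" "\<nu> \<ge> 0" by (auto simp: \<mu>_def \<nu>_def t_def)
  \<comment> \<open>The norm form is at most \<open>(\<bar>a\<bar> + 3 * \<bar>m\<bar>) ^ 2\<close>,
    and both absolute values, scaled by \<open>t\<close>, have just been bounded through
    \<open>S\<close>.\<close>
  have "real_of_int p * t ^ 2 \<le> \<nu> ^ 2 + 3 * \<nu> * \<mu> + 9 * \<mu> ^ 2"
  proof -
    have "real_of_int p = \<bar>real_of_int a\<bar> ^ 2 - 3 * (real_of_int a * real_of_int m) + 9 * \<bar>real_of_int m\<bar> ^ 2"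
      by (simp add: p_eq)
    also have "\<dots> \<le> \<bar>real_of_int a\<bar> ^ 2 + 3 * (\<bar>real_of_int a\<bar> * \<bar>real_of_int m\<bar>) + 9 * \<bar>real_of_int m\<bar> ^ 2"
      using abs_ge_minus_self[of "real_of_int a * real_of_int m"] by (simp only: abs_mult)
    finally have "real_of_int p * t ^ 2 \<le> (\<bar>real_of_int a\<bar> ^ 2 + 3 * (\<bar>real_of_int a\<bar> * \<bar>real_of_int m\<bar>) + 9 * \<bar>real_of_int m\<bar> ^ 2) * t ^ 2"
      by (rule mult_right_mono) simp
    also have "\<dots> = \<nu> ^ 2 + 3 * \<nu> * \<mu> + 9 * \<mu> ^ 2"
      unfolding \<mu>_def \<nu>_def by (simp only: algebra_simps power2_eq_square)
    finally show ?thesis .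
  qed
  also have "\<dots> \<le> (\<nu> + 3 * \<mu>) ^ 2"
    using pos by (simp add: power2_eq_square algebra_simps)
  finally have "real_of_int p * t ^ 2 \<le> (\<nu> + 3 * \<mu>) ^ 2" .
  then have "sqrt (real_of_int p * t ^ 2) \<le> \<nu> + 3 * \<mu>"
    using pos by (intro real_le_lsqrt) auto
  moreover have "sqrt (real_of_int p * t ^ 2) = sqrt p * t"
    by (simp add: real_sqrt_mult t_def)
  moreover have "\<nu> + 3 * \<mu> \<le> (n + 3) * S"
    using a m by (simp add: \<mu>_def \<nu>_def algebra_simps)
  ultimately show ?thesis
    by (simp add: S_def h_def d_def t_def abs_minus_commute)
qed

end

section \<open>Prime divisors of the cubic polynomial are cubic residues\<close>

lemma eisenstein_mult_shift_cubed:
  "(of_int a + of_int (3 * m) * omega) * (of_int x + omega) ^ 3 =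
     of_int (a * (x ^ 3 - 3 * x + 1) - 9 * m * (x ^ 2 - x)) + of_int (3 * cform a m x) * omega"
proof -
  have "(of_int x + omega) ^ 3 = of_int x ^ 3 + 3 * of_int x ^ 2 * omega + 3 * of_int x * omega ^ 2 + omega ^ 3"
    by (simp add: power2_eq_square power3_eq_cube algebra_simps)
  also have "\<dots> = of_int (x ^ 3 - 3 * x + 1) + of_int (3 * x ^ 2 - 3 * x) * omega"
    by (simp add: omega_sq omega_cubed algebra_simps)
  finally have *: "(of_int x + omega) ^ 3 = of_int (x ^ 3 - 3 * x + 1) + of_int (3 * x ^ 2 - 3 * x) * omega" .
  have prod: "(of_int a + of_int b * omega) * (of_int c + of_int d * omega) =
      of_int (a * c - b * d) + of_int (a * d + b * c - b * d) * omega" for a b c d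
  proof -
    have "(of_int a + of_int b * omega) * (of_int c + of_int d * omega) =
        of_int a * of_int c + of_int (a * d + b * c) * omega + of_int (b * d) * (omega * omega)"
      by (simp add: algebra_simps)
    then show ?thesis by (simp add: omega_mult_omega algebra_simps)
  qed
  show ?thesis
    unfolding * prod eisenstein_eq_iff cform_def by (simp add: algebra_simps)
qed

lemma eisenstein_norm:
  "(of_int a + of_int b * omega) * cnj (of_int a + of_int b * omega) = of_int (a ^ 2 - a * b + b ^ 2)"
proof -
  have "(of_int a + of_int b * omega) * cnj (of_int a + of_int b * omega)
      = of_int a ^ 2 - of_int a * of_int b - of_int b ^ 2 * (omega + omega * omega)"
    by (simp add: cnj_omega power2_eq_square algebra_simps)
  then show ?thesis by (simp add: omega_mult_omega)
qed

context cubic_character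
begin

text \<open>Frobenius at the prime 3, applied to the trace of \<open>G ^ 3\<close>, shows that
  \<open>-J\<close> is congruent to \<open>\<chi> t ^ 3 = 1\<close> modulo 3. So 3 divides the
  \<open>omega\<close>-coefficient of \<open>J\<close>, and the norm of \<open>J\<close> is
  \<open>p\<close>.\<close>

lemma J_coeffs:
  obtains a m where "J = of_int a + of_int (3 * m) * omega" "int p = a ^ 2 - 3 * a * m + 9 * m ^ 2"
proof -
  obtain a b where J: "J = of_int a + of_int b * omega"
    using J_mem by (auto simp: eisenstein_def)
  have "coprime 3 p"
    using prime_p p_neq_3 by (intro primes_coprime) auto
  then obtain t where t: "[3 * t = 1] (mod p)"
    using coprime_iff_invertible_nat by auto
  have "\<not> p dvd t"
    using t prime_p prime_gt_1_nat[of p] by (auto simp: cong_def elim!: dvdE)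
  then have "\<chi> t ^ 3 = 1" by (rule chi_cubed)
  then have "eisenstein.scong 3 (- J) 1"
    using trace1_G_freshman[of 3 1 t] t trace1_G_cubed by simp
  then have "[- a = 1] (mod 3)" "[- b = 0] (mod 3)"
    using scong_eisenstein_iff[of 3 "- a" "- b" 1 0] by (auto simp: J)
  then obtain m where m: "b = 3 * m"
    by (auto simp: cong_0_iff)
  have "(of_int (int p) :: complex) = of_int (a ^ 2 - a * b + b ^ 2)"
    using J_mult_cnj eisenstein_norm[of a b] by (simp add: J)
  then have "int p = a ^ 2 - a * b + b ^ 2"
    by (simp only: of_int_eq_iff)
  then show ?thesis using J m by (intro that[of a m]) (simp_all add: power2_eq_square)
qed

text \<open>The cube roots of unity stay distinct modulo every rational prime, even 3, because
  \<open>omega\<close> and its square have \<open>omega\<close>-coefficients 1 and -1.\<close>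

lemma chi_eq_1_if_scong:
  assumes "prime q" "eisenstein.scong (int q) (\<chi> t) 1" "\<not> p dvd t"
  shows "\<chi> t = 1"
proof -
  obtain k where "k < 3" and k: "\<chi> t = omega ^ k"
    using chi_range assms(3) by blast
  have q: "\<not> int q dvd 1" "\<not> int q dvd - 1"
    using prime_gt_1_nat[OF assms(1)] by auto
  have "\<not> eisenstein.scong (int q) omega 1"
    using scong_eisenstein_iff[of "int q" 0 1 1 0] q by (auto simp: cong_0_iff)
  moreover have "\<not> eisenstein.scong (int q) (omega ^ 2) 1"
    using scong_eisenstein_iff[of "int q" "- 1" "- 1" 1 0] q by (auto simp: cong_0_iff omega_sq)
  moreover have "k = 0 \<or> k = 1 \<or> k = 2"
    using \<open>k < 3\<close> by auto
  ultimately show ?thesis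
    using assms(2) by (auto simp: k)
qed

text \<open>With \<open>w = p * J = g ^ 3\<close>, the congruence of \<open>J * \<alpha> ^ 3\<close>
  with its conjugate makes \<open>w * \<alpha> ^ 6\<close> congruent to the cube of
  \<open>\<beta>\<close>. Raising this to the power \<open>r\<close>, where
  \<open>n = 3 * r + 1\<close> is \<open>q\<close> or its square, and using Fermat gives
  \<open>w ^ r\<close> congruent to 1. But \<open>w ^ r = g ^ (n - 1)\<close> is the trace of
  \<open>G ^ n\<close>, which is congruent to \<open>\<chi> t\<close> for \<open>t\<close> inverse
  to \<open>n\<close> modulo \<open>p\<close>.\<close>

lemma chi_eq_1_if_dvd_cform:
  assumes q: "prime q" "q \<noteq> 3" "q \<noteq> p"
    and J: "J = of_int a + of_int (3 * m) * omega"
    and dvd: "int q dvd cform a m x" and ndvd: "\<not> int q dvd x ^ 2 - x + 1"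
  shows "\<chi> q = 1"
proof -
  note mems = eisenstein.mult_mem eisenstein.power_mem cnj_mem_eisenstein eisenstein.of_int_mem
    eisenstein.add_mem omega_mem J_mem
  define \<alpha> where "\<alpha> = of_int x + omega"
  have \<alpha>: "\<alpha> \<in> eisenstein" unfolding \<alpha>_def by (intro mems)
  have norm_\<alpha>: "\<alpha> * cnj \<alpha> = of_int (x ^ 2 - x + 1)"
    using eisenstein_norm[of x 1] by (simp add: \<alpha>_def)

  have "\<not> 3 dvd q" using q primes_dvd_imp_eq[of 3 q] by auto
  then have "q mod 3 = 1 \<or> q mod 3 = 2" by presburger
  then have "q ^ 1 mod 3 = 1 \<or> q ^ 2 mod 3 = 1"
    by (auto simp: power_mod[symmetric, of q 2])
  then obtain k where k: "k \<in> {1, 2}" "q ^ k mod 3 = 1" by blast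
  define n where "n = q ^ k"
  define r where "r = n div 3"
  have n: "n = 3 * r + 1" using k(2) unfolding n_def r_def by presburger
  have fermat: "eisenstein.scong (int q) (z ^ n) z" if "z \<in> eisenstein" for z
    using eisenstein_fermat[OF q(1) k(2) that] by (simp add: n_def)

  have X: "J * \<alpha> ^ 3 = of_int (a * (x ^ 3 - 3 * x + 1) - 9 * m * (x ^ 2 - x)) + of_int (3 * cform a m x) * omega"
    unfolding J \<alpha>_def by (rule eisenstein_mult_shift_cubed)
  have "J * \<alpha> ^ 3 - cnj (J * \<alpha> ^ 3) = of_int (cform a m x) * (3 * (1 + 2 * omega))"
    unfolding X by (simp add: cnj_omega algebra_simps)
  moreover obtain c where "cform a m x = int q * c" using dvd by (elim dvdE)
  ultimately have "J * \<alpha> ^ 3 - cnj (J * \<alpha> ^ 3) = of_int (int q) * (of_int c * (of_int 3 * (of_int 1 + of_int 2 * omega)))"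
    by simp
  moreover have "of_int c * (of_int 3 * (of_int 1 + of_int 2 * omega)) \<in> eisenstein"
    by (intro mems)
  ultimately have conj: "eisenstein.scong (int q) (J * \<alpha> ^ 3) (cnj (J * \<alpha> ^ 3))"
    unfolding eisenstein.scong_def by blast

  define \<beta> where "\<beta> = cnj J * cnj \<alpha> ^ 2"
  have \<beta>: "\<beta> \<in> eisenstein" unfolding \<beta>_def by (intro mems \<alpha>)
  define w where "w = of_nat p * J"
  have w: "w \<in> eisenstein" unfolding w_def by (intro mems eisenstein.of_nat_mem)
  have "w * \<alpha> ^ 6 = (J * \<alpha> ^ 3) ^ 2 * cnj J"
  proof -
    have "w * \<alpha> ^ 6 = (J * cnj J) * J * (\<alpha> ^ 3) ^ 2"
      by (simp add: w_def J_mult_cnj power_mult[symmetric])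
    then show ?thesis by (simp add: power2_eq_square mult_ac)
  qed
  moreover have "eisenstein.scong (int q) ((J * \<alpha> ^ 3) ^ 2 * cnj J) (cnj (J * \<alpha> ^ 3) ^ 2 * cnj J)"
    by (intro eisenstein.scong_mult eisenstein.scong_power conj eisenstein.scong_refl mems \<alpha>)
  moreover have "cnj (J * \<alpha> ^ 3) ^ 2 * cnj J = \<beta> ^ 3"
    by (simp add: \<beta>_def power2_eq_square power3_eq_cube mult_ac)
  ultimately have "eisenstein.scong (int q) (w * \<alpha> ^ 6) (\<beta> ^ 3)" by simp
  then have "eisenstein.scong (int q) ((w * \<alpha> ^ 6) ^ r) ((\<beta> ^ 3) ^ r)"
    by (intro eisenstein.scong_power mems w \<alpha> \<beta>)
  \<comment> \<open>The extra factor completes the exponents \<open>6 * r\<close> of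
    \<open>\<alpha>\<close> and \<open>3 * r\<close> of \<open>\<beta>\<close> to
    \<open>2 * n\<close> and \<open>n\<close>, so that Fermat applies.\<close>
  then have "eisenstein.scong (int q) ((w * \<alpha> ^ 6) ^ r * (\<alpha> ^ 2 * \<beta>)) ((\<beta> ^ 3) ^ r * (\<alpha> ^ 2 * \<beta>))"
    by (intro eisenstein.scong_mult eisenstein.scong_refl mems w \<alpha> \<beta>)
  moreover have "(w * \<alpha> ^ 6) ^ r * (\<alpha> ^ 2 * \<beta>) = w ^ r * ((\<alpha> ^ n) ^ 2 * \<beta>)"
  proof -
    have "\<alpha> ^ (6 * r) * \<alpha> ^ 2 = (\<alpha> ^ n) ^ 2"
      unfolding power_add[symmetric] power_mult[symmetric] by (simp add: n)
    then show ?thesis by (simp add: power_mult_distrib power_mult[symmetric] mult_ac)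
  qed
  moreover have "(\<beta> ^ 3) ^ r * (\<alpha> ^ 2 * \<beta>) = \<beta> ^ n * \<alpha> ^ 2"
  proof -
    have "\<beta> ^ n = (\<beta> ^ 3) ^ r * \<beta>"
      by (simp only: n power_add power_mult power_one_right)
    then show ?thesis by (simp only: mult_ac)
  qed
  ultimately have 1: "eisenstein.scong (int q) (w ^ r * ((\<alpha> ^ n) ^ 2 * \<beta>)) (\<beta> ^ n * \<alpha> ^ 2)"
    by simp
  have "eisenstein.scong (int q) (w ^ r * (\<alpha> ^ 2 * \<beta>)) (w ^ r * ((\<alpha> ^ n) ^ 2 * \<beta>))"
    by (intro eisenstein.scong_mult eisenstein.scong_refl eisenstein.scong_power
        eisenstein.scong_sym[OF fermat] mems w \<alpha> \<beta>)
  also note 1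
  also have "eisenstein.scong (int q) (\<beta> ^ n * \<alpha> ^ 2) (\<beta> * \<alpha> ^ 2)"
    by (intro eisenstein.scong_mult fermat eisenstein.scong_refl mems \<alpha> \<beta>)
  finally have "eisenstein.scong (int q) (w ^ r * (\<alpha> ^ 2 * \<beta>)) (\<beta> * \<alpha> ^ 2)" .
  \<comment> \<open>Multiplication by \<open>J\<close> turns \<open>\<beta> * \<alpha> ^ 2\<close>
    into a rational integer prime to \<open>q\<close>, which can be cancelled.\<close>
  then have "eisenstein.scong (int q) (J * (w ^ r * (\<alpha> ^ 2 * \<beta>))) (J * (\<beta> * \<alpha> ^ 2))"
    by (rule eisenstein.scong_mult[OF eisenstein.scong_refl]) (intro mems \<alpha> \<beta>)+
  moreover define u where "u = int p * (x ^ 2 - x + 1) ^ 2"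
  have u: "J * (\<beta> * \<alpha> ^ 2) = of_int u"
  proof -
    have "J * (\<beta> * \<alpha> ^ 2) = (J * cnj J) * (\<alpha> * cnj \<alpha>) ^ 2"
      by (simp add: \<beta>_def power_mult_distrib mult_ac)
    then show ?thesis by (simp add: J_mult_cnj norm_\<alpha> u_def)
  qed
  moreover have "J * (w ^ r * (\<alpha> ^ 2 * \<beta>)) = of_int u * w ^ r"
    unfolding u[symmetric] by (simp add: mult_ac)
  ultimately have "eisenstein.scong (int q) (of_int u * w ^ r) (of_int u * 1)"
    by simp
  moreover have "coprime u (int q)"
  proof -
    have "coprime (int p) (int q)"
      using q prime_p by (simp add: primes_coprime)
    moreover have "coprime (x ^ 2 - x + 1) (int q)"
      using ndvd q(1) by (simp add: prime_imp_coprime coprime_commute)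
    ultimately show ?thesis by (simp add: u_def)
  qed
  ultimately have w1: "eisenstein.scong (int q) (w ^ r) 1"
    using eisenstein.scong_cancel_of_int[of u "int q" "w ^ r" 1] eisenstein.power_mem[OF w]
      eisenstein.one_mem by blast

  have "coprime (q ^ k) p"
    using q prime_p by (simp add: primes_coprime)
  then obtain t where t: "[n * t = 1] (mod p)"
    using coprime_iff_invertible_nat[of n p] by (auto simp: n_def)
  have pt: "\<not> p dvd t"
    using t prime_p prime_gt_1_nat[of p] by (auto simp: cong_def elim!: dvdE)
  have "trace1 (G ^ n) = g ^ (n - 1)"
    using k(2) by (intro trace1_G_power_mod) (simp add: n_def)
  also have "\<dots> = w ^ r"
    using p_gt_0 by (simp add: n w_def J_def power_mult)
  finally have "trace1 (G ^ n) = w ^ r" .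
  then have "eisenstein.scong (int q) (w ^ r) (\<chi> t ^ n)"
    using trace1_G_freshman[OF q(1), of k t] t by (simp add: n_def)
  moreover have "\<chi> t ^ n = \<chi> t"
    using n by (intro chi_power_mod) auto
  ultimately have "eisenstein.scong (int q) (\<chi> t) 1"
    using w1 by (metis eisenstein.scong_sym eisenstein.scong_trans)
  then have "\<chi> t = 1"
    using q(1) pt by (intro chi_eq_1_if_scong)
  moreover have "\<chi> (n * t) = 1"
    using t chi_mod[of "n * t"] chi_mod[of 1] chi_1 by (simp add: cong_def)
  ultimately have n1: "\<chi> n = 1" by (simp add: chi_mult)
  have "\<chi> q ^ 3 = 1"
    using q prime_p primes_dvd_imp_eq[of p q] by (intro chi_cubed) auto
  then have cube: "\<chi> q * (\<chi> q * \<chi> q) = 1"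
    by (simp add: power3_eq_cube mult.assoc)
  \<comment> \<open>If \<open>n\<close> is the square of \<open>q\<close>, then both the square and
    the cube of \<open>\<chi> q\<close> are 1.\<close>
  from k(1) consider "n = q" | "n = q * q"
    by (auto simp: n_def power2_eq_square)
  then show ?thesis
  proof cases
    case 1
    then show ?thesis using n1 by simp
  next
    case 2
    then have "\<chi> q * \<chi> q = 1" using n1 chi_mult by metis
    then show ?thesis using cube by simp
  qed
qed

end

text \<open>The character is \<open>omega\<close> to the index with respect to a primitive root.
  Indices are determined modulo \<open>p - 1\<close>, hence modulo 3, and value 1 means that 3
  divides the index.\<close>

lemma cubic_character_exists:
  assumes "prime p" "p mod 3 = 1"
  obtains \<chi> where "cubic_character p \<chi>"
    and "\<And>a. \<chi> a = 1 \<Longrightarrow> \<exists>y. [a = y ^ 3] (mod p)"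
proof -
  have p: "p > 1" using assms(1) prime_gt_1_nat by blast
  obtain r where r: "residue_primroot p r"
    using prime_primitive_root_exists[OF p assms(1)] by blast
  have cop: "coprime p r" and ord: "ord p r = p - 1"
    using r assms(1) by (auto simp: residue_primroot_def totient_prime)
  have "3 dvd p - 1" using assms(2) by presburger
  have pow_cong: "omega ^ i = omega ^ j" if "[r ^ i = r ^ j] (mod p)" for i j
  proof -
    have "[i = j] (mod p - 1)"
      using that order_divides_expdiff[OF cop] ord by simp
    then have "[i = j] (mod 3)"
      using \<open>3 dvd p - 1\<close> cong_dvd_modulus_nat by blast
    then show ?thesis
      by (metis cong_def omega_power_mod)
  qed
  have ex: "\<exists>i. [r ^ i = a] (mod p)" if "\<not> p dvd a" for a
  proof -
    have "a mod p \<in> totatives p"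
      using that p assms(1) by (simp add: totatives_prime dvd_eq_mod_eq_0)
    then have "a mod p \<in> (\<lambda>i. r ^ i mod p) ` {..<totient p}"
      using residue_primroot_is_generator[OF p r] by (simp add: bij_betw_def)
    then show ?thesis by (auto simp: cong_def)
  qed
  define ind where "ind = (\<lambda>a. SOME i. [r ^ i = a] (mod p))"
  have ind: "[r ^ ind a = a] (mod p)" if "\<not> p dvd a" for a
    unfolding ind_def using ex[OF that] by (rule someI_ex)
  define \<chi> where "\<chi> = (\<lambda>a. if p dvd a then 0 else omega ^ ind a)"
  have chi: "\<chi> a = omega ^ i" if "[r ^ i = a] (mod p)" for a i
  proof -
    have "coprime (r ^ i) p" using cop coprime_commute by auto
    then have "coprime a p" using that cong_imp_coprime by blast
    then have "\<not> p dvd a" using p by (metis coprime_absorb_right nat_dvd_1_iff_1 less_irrefl)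
    moreover from this have "[r ^ ind a = r ^ i] (mod p)"
      using ind that by (meson cong_sym cong_trans)
    ultimately show ?thesis using pow_cong by (simp add: \<chi>_def)
  qed
  have "cubic_character p \<chi>"
  proof
    show "prime p" by fact
    show "p \<noteq> 3" using assms(2) by auto
    show "\<chi> (a * b) = \<chi> a * \<chi> b" for a b
    proof (cases "p dvd a \<or> p dvd b")
      case True
      then show ?thesis by (auto simp: \<chi>_def)
    next
      case False
      then have "[r ^ ind a * r ^ ind b = a * b] (mod p)"
        using ind by (intro cong_mult) auto
      then have "\<chi> (a * b) = omega ^ (ind a + ind b)"
        by (intro chi) (simp add: power_add)
      then show ?thesis using False by (simp add: \<chi>_def power_add)
    qed
    show "\<chi> (a mod p) = \<chi> a" for a
      by (simp add: \<chi>_def ind_def dvd_mod_iff cong_def)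
    show "p dvd a \<Longrightarrow> \<chi> a = 0" for a by (simp add: \<chi>_def)
    show "\<exists>k<3. \<chi> a = omega ^ k" if "\<not> p dvd a" for a
      using that omega_power_mod[of "ind a"] by (intro exI[of _ "ind a mod 3"]) (simp add: \<chi>_def)
    have "\<chi> r = omega ^ 1"
      by (intro chi) simp
    moreover have "omega \<noteq> 1" by (simp add: omega_def complex_eq_iff)
    ultimately show "\<exists>r. \<not> p dvd r \<and> \<chi> r \<noteq> 1"
      using cop p by (intro exI[of _ r]) (auto simp: coprime_absorb_left)
  qed
  moreover have "\<exists>y. [a = y ^ 3] (mod p)" if "\<chi> a = 1" for a
  proof -
    have a: "\<not> p dvd a" using that by (auto simp: \<chi>_def)
    then have "omega ^ (ind a mod 3) = 1"
      using that by (simp add: \<chi>_def omega_power_mod)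
    moreover have "omega \<noteq> 1" "omega ^ 2 \<noteq> 1"
      by (simp_all add: omega_sq) (simp_all add: omega_def complex_eq_iff)
    moreover have "ind a mod 3 \<in> {0, 1, 2}" by auto
    ultimately have "ind a mod 3 = 0" by auto
    then obtain j where "ind a = j * 3" by (metis mod_0_imp_dvd dvd_div_mult_self)
    then have "[(r ^ j) ^ 3 = a] (mod p)" using ind[OF a] by (simp add: power_mult)
    then show ?thesis using cong_sym by blast
  qed
  ultimately show ?thesis using that by blast
qed

theorem cubic_form_prime_divisors:
  assumes "prime p" "p mod 3 = 1"
  obtains a m where "int p = a ^ 2 - 3 * a * m + 9 * m ^ 2"
    and "\<And>q x. prime q \<Longrightarrow> q \<noteq> 3 \<Longrightarrow> q \<noteq> p \<Longrightarrow> int q dvd cform a m x \<Longrightarrow> cubic_residue (int q) p"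
proof -
  obtain \<chi> where "cubic_character p \<chi>"
    and cube: "\<And>a. \<chi> a = 1 \<Longrightarrow> \<exists>y. [a = y ^ 3] (mod p)"
    using cubic_character_exists[OF assms] by blast
  then interpret cubic_character p \<chi> by simp
  obtain a m where J: "J = of_int a + of_int (3 * m) * omega"
    and am: "int p = a ^ 2 - 3 * a * m + 9 * m ^ 2"
    by (rule J_coeffs)
  have "cubic_residue (int q) p" if q: "prime q" "q \<noteq> 3" "q \<noteq> p" "int q dvd cform a m x" for q x
  proof -
    have "\<not> int q dvd int p"
      using q assms(1) primes_dvd_imp_eq[of q p] by auto
    then have "\<not> int q dvd x ^ 2 - x + 1"
      using dvd_norm_if_dvd_cform[OF q(4)] am by metis
    then have "\<chi> q = 1"
      using chi_eq_1_if_dvd_cform[OF q(1-3) J q(4)] by blast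
    then obtain y where y: "[q = y ^ 3] (mod p)" using cube by blast
    have "\<not> p dvd q"
      using q assms(1) primes_dvd_imp_eq[of p q] by auto
    then show ?thesis
      unfolding cubic_residue_def using y
      by (auto simp: cong_0_iff cong_int_iff[symmetric] intro: exI[of _ "int y"])
  qed
  then show ?thesis using am that by blast
qed

section \<open>Erdos' product argument\<close>

lemma prod_diff_eq_fact: "(\<Prod>x\<in>{y<..y + int n}. x - y) = fact n"
proof -
  have "(\<Prod>x\<in>{y<..y + int n}. x - y) = (\<Prod>k\<in>{1..n}. int k)"
    by (rule prod.reindex_bij_witness[of _ "\<lambda>k. y + int k" "\<lambda>x. nat (x - y)"]) auto
  then show ?thesis by (simp add: fact_prod)
qed

text \<open>The differences on the two sides of \<open>y\<close> multiply to two factorials, whose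
  product divides the factorial of the sum by integrality of binomial coefficients.\<close>

lemma prod_diff_dvd_fact:
  fixes y :: int
  assumes "y \<in> {lo..hi}"
  shows "(\<Prod>x\<in>{lo..hi} - {y}. \<bar>x - y\<bar>) dvd fact (nat (hi - lo))"
proof -
  have 1: "(\<Prod>x\<in>{y<..hi}. \<bar>x - y\<bar>) = fact (nat (hi - y))"
    using assms prod_diff_eq_fact[of y "nat (hi - y)"] by simp
  have "(\<Prod>x\<in>{lo..<y}. \<bar>x - y\<bar>) = (\<Prod>x\<in>{- y<..- lo}. x - (- y))"
    by (rule prod.reindex_bij_witness[of _ uminus uminus]) auto
  moreover have "(\<Prod>x\<in>{- y<..- lo}. x - (- y)) = fact (nat (y - lo))"
    using assms prod_diff_eq_fact[of "- y" "nat (y - lo)"] by simp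
  ultimately have 2: "(\<Prod>x\<in>{lo..<y}. \<bar>x - y\<bar>) = fact (nat (y - lo))"
    by (rule trans)
  have split: "{lo..hi} - {y} = {lo..<y} \<union> {y<..hi}" using assms by auto
  have "(\<Prod>x\<in>{lo..hi} - {y}. \<bar>x - y\<bar>) =
      (\<Prod>x\<in>{lo..<y}. \<bar>x - y\<bar>) * (\<Prod>x\<in>{y<..hi}. \<bar>x - y\<bar>)"
    unfolding split by (rule prod.union_disjoint) auto
  also have "\<dots> = fact (nat (y - lo)) * fact (nat (hi - y))"
    by (simp only: 1 2)
  also have "\<dots> dvd fact (nat (y - lo) + nat (hi - y))"
    by (rule fact_fact_dvd_fact)
  also have "nat (y - lo) + nat (hi - y) = nat (hi - lo)"
    using assms by auto
  finally show ?thesis .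
qed

text \<open>Erdos' device for products of consecutive values: within a residue class of zeros modulo \<open>q\<close>
  the value of maximal \<open>q\<close>-adic valuation is discarded, and unique lifting bounds the
  remaining valuations by those of differences of arguments.\<close>

lemma lifting_representatives:
  fixes F :: "int \<Rightarrow> int" and q :: int
  assumes "finite I" "\<And>x. x \<in> I \<Longrightarrow> F x \<noteq> 0" "prime q"
    and lift: "\<And>x y k. x \<in> I \<Longrightarrow> y \<in> I \<Longrightarrow> q dvd F x \<Longrightarrow> q dvd x - y \<Longrightarrow>
                 q ^ k dvd F x \<Longrightarrow> q ^ k dvd F y \<Longrightarrow> q ^ k dvd x - y"
  obtains R where "R \<subseteq> I" "card R \<le> card ((\<lambda>x. x mod q) ` {x \<in> I. q dvd F x})"
    "\<And>x. x \<in> I - R \<Longrightarrow> q dvd F x \<Longrightarrow> \<exists>y\<in>R. multiplicity q (F x) \<le> multiplicity q (x - y)"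
proof -
  define C where "C = (\<lambda>x. x mod q) ` {x \<in> I. q dvd F x}"
  define v where "v = (\<lambda>x. multiplicity q (F x))"
  have "\<exists>y. (y \<in> I \<and> q dvd F y \<and> y mod q = c) \<and> (\<forall>x. x \<in> I \<and> q dvd F x \<and> x mod q = c \<longrightarrow> v x \<le> v y)"
    if "c \<in> C" for c
  proof -
    define S where "S = {x \<in> I. q dvd F x \<and> x mod q = c}"
    have S: "finite S" "S \<noteq> {}" using that assms(1) by (auto simp: S_def C_def)
    then obtain y where "y \<in> S" "v y = Max (v ` S)"
      by (metis (mono_tags, lifting) Max_in finite_imageI image_iff image_is_empty)
    then show ?thesis using S by (intro exI[of _ y]) (auto simp: S_def)
  qed
  then obtain f where f: "\<And>c. c \<in> C \<Longrightarrow> f c \<in> I \<and> q dvd F (f c) \<and> f c mod q = c"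
    and fmax: "\<And>c x. c \<in> C \<Longrightarrow> x \<in> I \<Longrightarrow> q dvd F x \<Longrightarrow> x mod q = c \<Longrightarrow> v x \<le> v (f c)"
    by metis
  have "finite C" using assms(1) by (simp add: C_def)
  show ?thesis
  proof (rule that[of "f ` C"])
    show "f ` C \<subseteq> I" using f by auto
    show "card (f ` C) \<le> card ((\<lambda>x. x mod q) ` {x \<in> I. q dvd F x})"
      using card_image_le[OF \<open>finite C\<close>] by (simp add: C_def)
    fix x assume x: "x \<in> I - f ` C" "q dvd F x"
    define c where "c = x mod q"
    have c: "c \<in> C" using x by (auto simp: C_def c_def)
    define y where "y = f c"
    have y: "y \<in> I" "q dvd F y" "y mod q = x mod q" using f[OF c] by (auto simp: y_def c_def)
    have "q ^ v x dvd F x" by (simp add: v_def multiplicity_dvd)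
    moreover have "q ^ v x dvd F y"
      using fmax[OF c, of x] x by (auto simp: v_def y_def c_def intro!: multiplicity_dvd')
    moreover have "q dvd x - y" using y(3) by (metis mod_eq_dvd_iff)
    ultimately have "q ^ v x dvd x - y"
      using lift x y by blast
    moreover have "x \<noteq> y" using x c by (auto simp: y_def)
    moreover have "\<not> is_unit q" using assms(3) by auto
    ultimately have "v x \<le> multiplicity q (x - y)"
      by (intro multiplicity_geI) auto
    then show "\<exists>y\<in>f ` C. multiplicity q (F x) \<le> multiplicity q (x - y)"
      using c by (auto simp: v_def y_def)
  qed
qed

lemma multiplicity_abs: "multiplicity q \<bar>z\<bar> = multiplicity q (z :: int)"
  by (metis multiplicity_normalize_right normalize_int_def)

text \<open>\<open>R\<close> collects the discarded arguments of all primes in \<open>Q\<close>. For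
  each prime, the valuation left over is at most that of the products of differences from at most
  \<open>s\<close> representatives, each product dividing \<open>fact N\<close>. So the remaining
  product divides \<open>fact N ^ s\<close>.\<close>

lemma prod_values_le_fact_power:
  fixes F :: "int \<Rightarrow> int" and Q :: "nat set"
  assumes nz: "\<And>x. x \<in> {lo..hi} \<Longrightarrow> F x \<noteq> 0" and "finite Q" and primes: "\<And>q. q \<in> Q \<Longrightarrow> prime q"
    and Q: "\<And>x q. x \<in> {lo..hi} \<Longrightarrow> prime q \<Longrightarrow> int q dvd F x \<Longrightarrow> q \<in> Q"
    and roots: "\<And>q. q \<in> Q \<Longrightarrow> card ((\<lambda>x. x mod int q) ` {x \<in> {lo..hi}. int q dvd F x}) \<le> s"
    and lift: "\<And>q x y k. q \<in> Q \<Longrightarrow> x \<in> {lo..hi} \<Longrightarrow> y \<in> {lo..hi} \<Longrightarrow> int q dvd F x \<Longrightarrow>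
      int q dvd x - y \<Longrightarrow> int q ^ k dvd F x \<Longrightarrow> int q ^ k dvd F y \<Longrightarrow> int q ^ k dvd x - y"
  obtains R where "R \<subseteq> {lo..hi}" "card R \<le> s * card Q"
    "(\<Prod>x\<in>{lo..hi} - R. \<bar>F x\<bar>) \<le> fact (nat (hi - lo)) ^ s"
proof -
  define I where "I = {lo..hi}"
  define N where "N = nat (hi - lo)"
  have "\<exists>R. R \<subseteq> I \<and> card R \<le> s \<and> (\<forall>x\<in>I - R. int q dvd F x \<longrightarrow>
      (\<exists>y\<in>R. multiplicity (int q) (F x) \<le> multiplicity (int q) (x - y)))" if "q \<in> Q" for q
  proof -
    have q: "prime q" using primes that .
    obtain R where "R \<subseteq> I" "card R \<le> card ((\<lambda>x. x mod int q) ` {x \<in> I. int q dvd F x})"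
      "\<And>x. x \<in> I - R \<Longrightarrow> int q dvd F x \<Longrightarrow> \<exists>y\<in>R. multiplicity (int q) (F x) \<le> multiplicity (int q) (x - y)"
    proof (rule lifting_representatives[of I F "int q"])
      show "int q ^ k dvd x - y" if "x \<in> I" "y \<in> I" "int q dvd F x" "int q dvd x - y"
        "int q ^ k dvd F x" "int q ^ k dvd F y" for x y k
        using lift[OF \<open>q \<in> Q\<close>] that by (simp add: I_def)
    qed (use nz q in \<open>auto simp: I_def\<close>)
    then show ?thesis
      using roots[OF that] by (intro exI[of _ R]) (auto simp: I_def)
  qed
  then obtain Rf where Rf': "\<forall>q\<in>Q. Rf q \<subseteq> I \<and> card (Rf q) \<le> s \<and>
      (\<forall>x\<in>I - Rf q. int q dvd F x \<longrightarrow>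
        (\<exists>y\<in>Rf q. multiplicity (int q) (F x) \<le> multiplicity (int q) (x - y)))"
    using bchoice[of Q] by (metis (lifting))
  then have Rf: "\<And>q. q \<in> Q \<Longrightarrow> Rf q \<subseteq> I" "\<And>q. q \<in> Q \<Longrightarrow> card (Rf q) \<le> s"
    and Rfx: "\<And>q x. q \<in> Q \<Longrightarrow> x \<in> I - Rf q \<Longrightarrow> int q dvd F x \<Longrightarrow>
      (\<exists>y\<in>Rf q. multiplicity (int q) (F x) \<le> multiplicity (int q) (x - y))"
    by blast+
  define R where "R = (\<Union>q\<in>Q. Rf q)"
  define P where "P = (\<Prod>x\<in>I - R. \<bar>F x\<bar>)"
  have finI: "finite I" by (simp add: I_def)
  have "P dvd fact N ^ s"
  proof (rule multiplicity_le_imp_dvd)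
    show "P \<noteq> 0" using nz by (auto simp: P_def I_def)
    fix r :: int assume r: "prime r"
    define q where "q = nat r"
    have rq: "r = int q" using r by (simp add: q_def prime_ge_0_int)
    have q: "prime q" using r rq by simp
    have distrib: "multiplicity r (\<Prod>x\<in>A. f x) = (\<Sum>x\<in>A. multiplicity r (f x))"
      if "finite A" "\<And>x. x \<in> A \<Longrightarrow> f x \<noteq> 0" for A and f :: "int \<Rightarrow> int"
      using that r by (intro prime_elem_multiplicity_prod_distrib) auto
    have P: "multiplicity r P = (\<Sum>x\<in>I - R. multiplicity r (F x))"
      unfolding P_def using finI nz by (subst distrib) (auto simp: I_def multiplicity_abs)
    show "multiplicity r P \<le> multiplicity r (fact N ^ s)"
    proof (cases "q \<in> Q")
      case False
      then have "multiplicity r (F x) = 0" if "x \<in> I" for x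
        using that Q q rq by (intro not_dvd_imp_multiplicity_0) (auto simp: I_def)
      then show ?thesis by (simp add: P)
    next
      case True
      have finR: "finite (Rf q)" using Rf(1)[OF True] finI finite_subset by blast
      \<comment> \<open>The representative that bounds the valuation depends on \<open>x\<close>;
        summing over all of them removes the dependence and lets the two sums be exchanged.\<close>
      have "multiplicity r P \<le> (\<Sum>x\<in>I - R. \<Sum>y\<in>Rf q. multiplicity r (x - y))"
        unfolding P
      proof (rule sum_mono)
        fix x assume x: "x \<in> I - R"
        show "multiplicity r (F x) \<le> (\<Sum>y\<in>Rf q. multiplicity r (x - y))"
        proof (cases "r dvd F x")
          case True
          then obtain y where "y \<in> Rf q" "multiplicity r (F x) \<le> multiplicity r (x - y)"
            using Rfx[OF \<open>q \<in> Q\<close>, of x] x \<open>q \<in> Q\<close> by (auto simp: R_def rq)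
          then show ?thesis
            using member_le_sum[of y "Rf q" "\<lambda>y. multiplicity r (x - y)"] finR by fastforce
        qed (simp add: not_dvd_imp_multiplicity_0)
      qed
      also have "\<dots> = (\<Sum>y\<in>Rf q. \<Sum>x\<in>I - R. multiplicity r (x - y))"
        by (rule sum.swap)
      also have "\<dots> \<le> (\<Sum>y\<in>Rf q. multiplicity r (fact N))"
      proof (rule sum_mono)
        fix y assume y: "y \<in> Rf q"
        have sub: "I - R \<subseteq> I - {y}" using y True by (auto simp: R_def)
        have "(\<Sum>x\<in>I - R. multiplicity r (x - y)) \<le> (\<Sum>x\<in>I - {y}. multiplicity r \<bar>x - y\<bar>)"
          unfolding multiplicity_abs using sub finI by (intro sum_mono2) auto
        also have "\<dots> = multiplicity r (\<Prod>x\<in>I - {y}. \<bar>x - y\<bar>)"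
          using finI by (subst distrib) auto
        also have "\<dots> \<le> multiplicity r (fact N)"
          using y Rf(1)[OF True] prod_diff_dvd_fact[of y lo hi]
          by (intro dvd_imp_multiplicity_le) (auto simp: I_def N_def)
        finally show "(\<Sum>x\<in>I - R. multiplicity r (x - y)) \<le> multiplicity r (fact N)" .
      qed
      also have "\<dots> \<le> s * multiplicity r (fact N)"
        using Rf(2)[OF True] by simp
      also have "\<dots> = multiplicity r (fact N ^ s)"
        using r by (intro prime_elem_multiplicity_power_distrib[symmetric]) auto
      finally show ?thesis .
    qed
  qed
  then have "P \<le> fact N ^ s" by (rule zdvd_imp_le) simp
  moreover have "card R \<le> s * card Q"
  proof -
    have "card R \<le> (\<Sum>q\<in>Q. card (Rf q))"
      unfolding R_def using \<open>finite Q\<close> by (rule card_UN_le)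
    also have "\<dots> \<le> (\<Sum>q\<in>Q. s)" using Rf(2) by (intro sum_mono)
    finally show ?thesis by (simp add: mult.commute)
  qed
  moreover have "R \<subseteq> I" using Rf(1) by (auto simp: R_def)
  ultimately show ?thesis
    by (intro that[of R]) (auto simp: P_def I_def N_def)
qed

section \<open>Counting large prime cubic residues\<close>

lemma finite_primes_upto: "finite {q :: nat. prime q \<and> real q \<le> Y}"
  by (rule finite_subset[of _ "{..nat \<lfloor>Y\<rfloor>}"]) (auto simp: le_nat_floor)

text \<open>Apart from 2, 3 and 5, primes lie in the eight residue classes prime to 30. The density
  \<open>8 / 30\<close> and the \<open>1 / 15\<close> of the theorem add up to \<open>1 / 3\<close>,
  so that at most about \<open>Y / 3\<close> primes have to be treated below.\<close>

lemma card_primes_upto: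
  assumes "Y \<ge> 0"
  shows "real (card {q :: nat. prime q \<and> real q \<le> Y}) \<le> 8 * (Y / 30 + 1) + 3"
proof -
  define r where "r = {1, 7, 11, 13, 17, 19, 23, 29 :: nat}"
  define y where "y = nat \<lfloor>Y\<rfloor>"
  define f where "f = (\<lambda>(i, k :: nat). 30 * i + k :: nat)"
  have "{q :: nat. prime q \<and> real q \<le> Y} \<subseteq> {2, 3, 5} \<union> f ` ({..y div 30} \<times> r)"
  proof
    fix q :: nat assume "q \<in> {q. prime q \<and> real q \<le> Y}"
    then have q: "prime q" "q \<le> y" by (auto simp: y_def le_nat_floor)
    have "q mod 30 \<in> r" if "q \<noteq> 2" "q \<noteq> 3" "q \<noteq> 5"
    proof -
      have "\<not> 2 dvd q" "\<not> 3 dvd q" "\<not> 5 dvd q"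
        using that q(1) primes_dvd_imp_eq[of 2 q] primes_dvd_imp_eq[of 3 q] primes_dvd_imp_eq[of 5 q] by auto
      moreover have "q mod 30 < 30" by simp
      ultimately show ?thesis unfolding r_def by simp presburger
    qed
    moreover have "q div 30 \<le> y div 30" using q(2) by (rule div_le_mono)
    moreover have "q = f (q div 30, q mod 30)" by (simp add: f_def)
    ultimately show "q \<in> {2, 3, 5} \<union> f ` ({..y div 30} \<times> r)" by blast
  qed
  moreover have "finite ({2, 3, 5} \<union> f ` ({..y div 30} \<times> r))" by (simp add: r_def)
  ultimately have "card {q :: nat. prime q \<and> real q \<le> Y} \<le> card ({2, 3, 5} \<union> f ` ({..y div 30} \<times> r))"
    by (metis card_mono)
  also have "\<dots> \<le> card {2, 3, 5 :: nat} + card (f ` ({..y div 30} \<times> r))"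
    by (rule card_Un_le)
  also have "card (f ` ({..y div 30} \<times> r)) \<le> card ({..y div 30} \<times> r)"
    by (rule card_image_le) (simp add: r_def)
  also have "card ({..y div 30} \<times> r) = (y div 30 + 1) * 8"
    by (simp add: r_def card_cartesian_product)
  finally have "real (card {q :: nat. prime q \<and> real q \<le> Y}) \<le> real (3 + (y div 30 + 1) * 8)"
    by simp
  also have "real (y div 30) \<le> Y / 30"
  proof -
    have "real (y div 30) \<le> real y / 30" using of_nat_div_le_of_nat[of y 30] by simp
    also have "real y \<le> Y" using assms by (simp add: y_def)
    finally show ?thesis by simp
  qed
  then have "real (3 + (y div 30 + 1) * 8) \<le> 8 * (Y / 30 + 1) + 3" by simp
  finally show ?thesis .
qed

section \<open>Logarithmic estimates\<close>

lemma ln_2_le: "ln 2 \<le> (7 / 10 :: real)"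
proof -
  \<comment> \<open>The power \<open>(101 / 100) ^ 70\<close> slightly exceeds 2.\<close>
  have "ln 2 \<le> ln ((101 / 100) ^ 70 :: real)"
    by (subst ln_le_cancel_iff) (simp_all add: field_simps)
  also have "\<dots> = 70 * ln (101 / 100)" by (subst ln_realpow) simp_all
  also have "\<dots> \<le> 70 * (101 / 100 - 1)" by (intro mult_left_mono ln_le_minus_one) simp_all
  finally show ?thesis by simp
qed

text \<open>A weak Stirling bound; the induction step amounts to
  \<open>ln (1 + 1 / n) \<ge> 1 / (n + 1)\<close>.\<close>

lemma ln_fact_le: "n \<ge> 1 \<Longrightarrow> ln (fact n :: real) \<le> (real n + 1) * ln (real n) - real n + 1"
proof (induction n rule: nat_induct_at_least)
  case (Suc n)
  have n: "real n > 0" using Suc by simp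
  have "ln (real n / (real n + 1)) \<le> real n / (real n + 1) - 1"
    using n by (intro ln_le_minus_one) simp
  also have "\<dots> = - 1 / (real n + 1)" using n by (simp add: field_simps)
  finally have "1 / (real n + 1) \<le> ln (real n + 1) - ln (real n)"
    using n by (simp add: ln_div)
  then have "1 \<le> (real n + 1) * (ln (real n + 1) - ln (real n))"
    using n by (simp add: field_simps)
  moreover have "ln (fact (Suc n) :: real) = ln (real n + 1) + ln (fact n)"
    by (simp add: ln_mult add.commute)
  ultimately show ?case using Suc.IH by (simp add: algebra_simps)
qed simp

text \<open>Here \<open>L = ln n\<close>, and \<open>n\<^sup>2 \<surd>p / 2 ^ 18\<close> bounds the form from below on \<open>b\<close> of the arguments;
  and \<open>ln (2 ^ 18) \<le> 63 / 5\<close>.\<close>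

lemma final_numerics:
  fixes n b Y P L u :: real
  assumes n: "n \<ge> 424" and L: "L = ln n" and P: "P \<ge> 100" "P \<ge> 6 * u" and u: "u \<ge> L - 21 / 10"
    and Y: "Y \<le> 3 * (n + 1) / 17" and b: "b \<ge> n - Y - 35 - 3 * n / 50"
  shows "3 * ((n + 1) * L - n + 1) < b * (P / 2 + 2 * L - 63 / 5)"
proof -
  define W where "W = P / 2 + 2 * L - 63 / 5"
  have L0: "L \<ge> 0" using n by (simp add: L)
  \<comment> \<open>The tangent bound at \<open>512 = 2 ^ 9\<close>; the constant is
    \<open>9 * 7 / 10 - 1 = 53 / 10\<close>.\<close>
  have "ln (n / 512) \<le> n / 512 - 1" using n by (intro ln_le_minus_one) simp
  moreover have "ln (n / 512) = L - 9 * ln 2"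
    using n ln_realpow[of 2 9] by (simp add: L ln_div)
  ultimately have Ln: "L \<le> n / 512 + 53 / 10"
    using ln_2_le by linarith
  \<comment> \<open>\<open>W1\<close> comes from \<open>P \<ge> 100\<close> and \<open>W2\<close>
    from \<open>P \<ge> 6 * u\<close>. For large \<open>L\<close> only \<open>W2\<close> grows fast
    enough to exceed \<open>3 * L\<close> after the loss of a quarter of the arguments.\<close>
  have W1: "W \<ge> 2 * L + 374 / 10" using P by (simp add: W_def)
  have W2: "W \<ge> 5 * L - 189 / 10" using P u by (simp add: W_def)
  \<comment> \<open>Here \<open>c\<close> bounds the proportion of arguments kept, and
    \<open>d\<close> absorbs the terms of lower order.\<close>
  have key: "3 * ((n + 1) * L - n + 1) < b * W"
    if "b \<ge> c * n" "3 * L + 3 \<le> d * n" "c * W > 3 * L - 3 + d" "c \<ge> 0" for c d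
  proof -
    have "3 * ((n + 1) * L - n + 1) = n * (3 * L - 3) + (3 * L + 3)" by (simp add: algebra_simps)
    also have "\<dots> \<le> n * (3 * L - 3) + d * n" using that by simp
    also have "\<dots> = n * (3 * L - 3 + d)" by (simp add: algebra_simps)
    also have "\<dots> < n * (c * W)" using that n by (intro mult_strict_left_mono) auto
    also have "\<dots> = (c * n) * W" by simp
    also have "\<dots> \<le> b * W" using that W1 L0 by (intro mult_right_mono) auto
    finally show ?thesis .
  qed
  have "3 * ((n + 1) * L - n + 1) < b * W"
  \<comment> \<open>The constant loss of 35 arguments lowers the proportion to
    \<open>68 / 100\<close> for small \<open>n\<close>, where \<open>L\<close> is at most
    \<open>84 / 10\<close>; beyond 3500 the proportion is at least
    \<open>753 / 1000\<close>.\<close>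
  proof (cases "n < 3500")
    case True
    have "L \<le> ln (2 ^ 12)" unfolding L using n True by (subst ln_le_cancel_iff) auto
    also have "\<dots> = 12 * ln 2" by (simp only: ln_realpow)
    finally have "L \<le> 84 / 10" using ln_2_le by simp
    then show ?thesis
      using Ln Y b n W1 by (intro key[of "68 / 100" "6 / 100"]) auto
  next
    case False
    have "753 / 1000 * W > 3 * L - 3 + 12 / 1000"
    proof (cases "L \<ge> 18")
      case True
      then show ?thesis using W2 by simp
    next
      case False
      then show ?thesis using W1 by simp
    qed
    then show ?thesis
      using Ln Y b n False by (intro key[of "753 / 1000" "12 / 1000"]) auto
  qed
  then show ?thesis by (simp add: W_def)
qed

section \<open>The counted set and the two residue classes of \<open>p\<close> modulo 3\<close>

definition large_residues :: "nat \<Rightarrow> real \<Rightarrow> nat set" where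
  "large_residues p Y = {q. prime q \<and> Y < real q \<and> real q \<le> 72 * sqrt (real p) * Y ^ 3 \<and> cubic_residue (int q) p}"

lemma finite_large_residues: "finite (large_residues p Y)"
  by (rule finite_subset[OF _ finite_primes_upto[of "72 * sqrt (real p) * Y ^ 3"]]) (auto simp: large_residues_def)

text \<open>Cubing is invertible modulo \<open>p\<close>: with
  \<open>3 * k = 2 * (p - 1) + 1\<close>, Fermat makes \<open>q ^ k\<close> a cube root of
  \<open>q\<close>.\<close>

lemma cubic_residue_if_mod_3_eq_2:
  assumes "prime p" "p mod 3 = 2" "\<not> p dvd q"
  shows "cubic_residue (int q) p"
proof -
  have p: "p > 1" using assms(1) prime_gt_1_nat by blast
  define k where "k = (2 * p - 1) div 3"
  have "3 * k = 2 * p - 1" unfolding k_def using assms(2) p by presburger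
  then have k: "k * 3 = (p - 1) * 2 + 1" using p by simp
  have "[(q ^ (p - 1)) ^ 2 * q = 1 ^ 2 * q] (mod p)"
    by (intro cong_mult cong_pow fermat_theorem assms cong_refl)
  moreover have "(q ^ (p - 1)) ^ 2 * q = (q ^ k) ^ 3"
    unfolding power_mult[symmetric] k by (simp add: power_add)
  ultimately have "[q = (q ^ k) ^ 3] (mod p)" by (simp add: cong_sym_eq)
  then have "[int q = int (q ^ k) ^ 3] (mod int p)"
    by (metis cong_int_iff of_nat_power)
  then show ?thesis using assms(3) unfolding cubic_residue_def
    by (auto simp: cong_0_iff intro!: exI[of _ "int (q ^ k)"])
qed

text \<open>Erdos' argument for the identity function on the \<open>K\<close> integers following
  \<open>K ^ 2\<close>. With too few large primes, at least half of the integers survive, and their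
  product is at least \<open>K ^ K\<close>, yet at most \<open>fact (K - 1)\<close>.\<close>

lemma many_large_residues_2_mod_3:
  assumes p: "prime p" "p mod 3 = 2" and Y: "Y \<ge> 75" "Y ^ 6 \<le> real p"
  shows "Y / 15 \<le> real (card (large_residues p Y))"
proof (rule ccontr)
  assume T: "\<not> ?thesis"
  define K where "K = nat \<lceil>Y\<rceil>"
  have K: "Y \<le> real K" "real K \<le> Y + 1" using Y by (auto simp: K_def)
  define lo where "lo = int (K ^ 2 + 1)"
  define hi where "hi = int (K ^ 2 + K)"
  have lo0: "0 < lo" by (simp add: lo_def add_pos_nonneg)
  define Q where "Q = {q. prime q \<and> (\<exists>x\<in>{lo..hi}. int q dvd x)}"
  have "real (K ^ 2 + K) \<le> Y ^ 3"
  proof -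
    have "real (K ^ 2 + K) \<le> (Y + 1) ^ 2 + (Y + 1)"
      using K Y by (simp add: power_mono add_mono)
    also have "\<dots> = Y * Y + 3 * Y + 2" by (simp add: power2_eq_square algebra_simps)
    also have "\<dots> \<le> 75 * (Y * Y)"
      using Y mult_mono[of 1 Y 1 Y] mult_right_mono[of 1 Y Y] by linarith
    also have "\<dots> \<le> Y * (Y * Y)" using Y by (intro mult_right_mono) auto
    finally show ?thesis by (simp add: power3_eq_cube mult.assoc)
  qed
  moreover have "Y ^ 3 < Y ^ 6" using Y by (intro power_strict_increasing) auto
  moreover have "1 \<le> sqrt (real p)" using prime_gt_0_nat[OF p(1)] by simp
  then have "1 \<le> 72 * sqrt (real p)" by linarith
  then have "1 * Y ^ 3 \<le> 72 * sqrt (real p) * Y ^ 3" using Y by (intro mult_right_mono) simp_all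
  ultimately have size: "real (K ^ 2 + K) < real p" "real (K ^ 2 + K) \<le> 72 * sqrt (real p) * Y ^ 3"
    using Y(2) by linarith+
  have QT: "Q \<subseteq> {q. prime q \<and> real q \<le> Y} \<union> large_residues p Y"
  proof
    fix q assume "q \<in> Q"
    then obtain x where q: "prime q" and x: "x \<in> {lo..hi}" "int q dvd x" by (auto simp: Q_def)
    have "0 < x" using x(1) lo0 by simp
    then have "int q \<le> x" using x(2) by (rule zdvd_imp_le[rotated])
    then have "int q \<le> int (K ^ 2 + K)" using x(1) unfolding hi_def by (simp only: atLeastAtMost_iff) linarith
    then have le: "q \<le> K ^ 2 + K" by (simp only: of_nat_le_iff)
    then have "real q \<le> real (K ^ 2 + K)" by (simp only: of_nat_le_iff)
    then have "real q < real p" using size(1) by linarith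
    then have "q < p" by (simp only: of_nat_less_iff)
    then have "cubic_residue (int q) p"
      using p q prime_gt_0_nat[of q] by (intro cubic_residue_if_mod_3_eq_2) (auto dest: dvd_imp_le)
    moreover have "real q \<le> 72 * sqrt (real p) * Y ^ 3" using le size(2) by (meson of_nat_le_iff order_trans)
    ultimately show "q \<in> {q. prime q \<and> real q \<le> Y} \<union> large_residues p Y"
      using q by (auto simp: large_residues_def)
  qed
  have finQ: "finite Q"
    using QT by (rule finite_subset) (simp add: finite_primes_upto finite_large_residues)
  have cardQ: "real (card Q) \<le> Y / 3 + 11"
  proof -
    have "card Q \<le> card ({q. prime q \<and> real q \<le> Y} \<union> large_residues p Y)"
      using QT by (intro card_mono) (simp_all add: finite_primes_upto finite_large_residues)
    also have "\<dots> \<le> card {q. prime q \<and> real q \<le> Y} + card (large_residues p Y)" by (rule card_Un_le)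
    finally show ?thesis using card_primes_upto[of Y] T Y by simp
  qed
  obtain R where R: "R \<subseteq> {lo..hi}" "card R \<le> 1 * card Q"
    "(\<Prod>x\<in>{lo..hi} - R. \<bar>x\<bar>) \<le> fact (nat (hi - lo)) ^ 1"
  proof (rule prod_values_le_fact_power[of lo hi "\<lambda>x. x" Q 1])
    fix q assume "q \<in> Q"
    have "(\<lambda>x. x mod int q) ` {x \<in> {lo..hi}. int q dvd x} \<subseteq> {0}" by auto
    then have "card ((\<lambda>x. x mod int q) ` {x \<in> {lo..hi}. int q dvd x}) \<le> card {0::int}"
      by (intro card_mono) auto
    then show "card ((\<lambda>x. x mod int q) ` {x \<in> {lo..hi}. int q dvd x}) \<le> 1" by simp
  next
    show "int q ^ k dvd x - y" if "int q ^ k dvd x" "int q ^ k dvd y" for q k x y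
      using that by (rule dvd_diff)
  qed (use finQ lo0 in \<open>auto simp: Q_def\<close>)
  define B where "B = {lo..hi} - R"
  have "card B = K - card R"
    using R(1) by (simp add: B_def card_Diff_subset finite_subset[OF R(1)] lo_def hi_def)
  \<comment> \<open>As \<open>card R\<close> is at most \<open>Y / 3 + 11\<close>, this holds from
    \<open>Y \<ge> 66\<close> on.\<close>
  moreover have "2 * real (card R) \<le> real K"
    using R(2) cardQ K Y by simp
  ultimately have B: "K \<le> 2 * card B" by linarith
  have "K > 1" using K Y by linarith
  have "int (K ^ K) \<le> int (K ^ (2 * card B))"
    using B \<open>K > 1\<close> by (simp add: power_increasing)
  also have "\<dots> = (\<Prod>x\<in>B. int (K ^ 2))" by (simp add: power_mult)
  also have "\<dots> \<le> (\<Prod>x\<in>B. \<bar>x\<bar>)"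
    by (intro prod_mono) (auto simp: B_def lo_def)
  also have "\<dots> \<le> fact (K - 1)"
    using R(3) \<open>K > 1\<close> by (simp add: B_def lo_def hi_def nat_diff_distrib)
  also have "fact (K - 1) = int (fact (K - 1))" by simp
  finally have "K ^ K \<le> fact (K - 1)" by (simp only: of_nat_le_iff)
  also have "\<dots> \<le> (K - 1) ^ (K - 1)" by (metis fact_le_power of_nat_id)
  also have "\<dots> \<le> K ^ (K - 1)" by (rule power_mono) auto
  also have "\<dots> < K ^ K" using \<open>K > 1\<close> by (intro power_strict_increasing) auto
  finally show False by simp
qed

lemma many_large_residues_1_mod_3:
  assumes p: "prime p" "p mod 3 = 1" and Y: "Y \<ge> 75" "Y ^ 6 \<le> real p" and "exp 100 \<le> real p"
  shows "Y / 15 \<le> real (card (large_residues p Y))"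
proof (rule ccontr)
  assume T: "\<not> ?thesis"
  obtain a m where am: "int p = a ^ 2 - 3 * a * m + 9 * m ^ 2"
    and residue: "\<And>q x. prime q \<Longrightarrow> q \<noteq> 3 \<Longrightarrow> q \<noteq> p \<Longrightarrow> int q dvd cform a m x \<Longrightarrow> cubic_residue (int q) p"
    using cubic_form_prime_divisors[OF p] by blast
  have pint: "prime (int p)" using p by simp
  have p0: "real p > 0" using prime_gt_0_nat[OF p(1)] by simp
  define F where "F = cform a m"
  \<comment> \<open>The factor \<open>17 / 3\<close> is as large as the constant 72 comfortably
    allows: \<open>4 * (17 / 3) ^ 6 \<le> 27 * 72 ^ 2\<close>. A larger \<open>n\<close> weakens the
    loss of about \<open>Y\<close> arguments to the primes in \<open>Q\<close>.\<close>
  define n where "n = nat \<lfloor>17 * Y / 3\<rfloor>"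
  have n: "real n \<le> 17 * Y / 3" "17 * Y / 3 - 1 \<le> real n" using Y by (auto simp: n_def) linarith+
  have n424: "real n \<ge> 424" using n Y by linarith
  \<comment> \<open>Starting at 2 keeps \<open>x ^ 2 - x\<close> positive, as the lower bound for
    the form requires.\<close>
  define I where "I = {2..int n}"

  have arg_less_p: "0 < x ^ 2 - x + 1" "x ^ 2 - x + 1 < int p" if "x \<in> I" for x
  proof -
    have x: "2 \<le> x" "x \<le> int n" using that by (auto simp: I_def)
    have "2 * x \<le> x * x" using x by (intro mult_right_mono) auto
    then show "0 < x ^ 2 - x + 1" using x unfolding power2_eq_square by linarith
    have "x ^ 2 \<le> int n ^ 2" using x by (intro power_mono) auto
    then have "x ^ 2 - x + 1 \<le> int n ^ 2" using x by linarith
    also have "int n ^ 2 = int (n ^ 2)" by simp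
    also have "n ^ 2 < p"
    proof -
      have "real (n ^ 2) \<le> (17 * Y / 3) ^ 2" using n by (simp add: power_mono)
      also have "\<dots> = 289 / 9 * Y ^ 2" by (simp add: power2_eq_square)
      also have "\<dots> < 75 ^ 4 * Y ^ 2" using Y by (intro mult_strict_right_mono) auto
      also have "\<dots> \<le> Y ^ 4 * Y ^ 2" using Y by (intro mult_right_mono power_mono) auto
      also have "\<dots> = Y ^ 6" by (simp flip: power_add)
      finally have "real (n ^ 2) < real p" using Y(2) by linarith
      then show ?thesis by (simp only: of_nat_less_iff)
    qed
    then have "int (n ^ 2) < int p" by (simp only: of_nat_less_iff)
    finally show "x ^ 2 - x + 1 < int p" .
  qed
  have ndvd: "\<not> int p dvd F x" if "x \<in> I" for x
    unfolding F_def using arg_less_p[OF that] by (intro not_p_dvd_cform[OF pint am])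
  then have nz: "F x \<noteq> 0" if "x \<in> I" for x using that by (metis dvd_0_right)

  define Q where "Q = {q. prime q \<and> (\<exists>x\<in>I. int q dvd F x)}"
  have QT: "Q \<subseteq> {q. prime q \<and> real q \<le> Y} \<union> large_residues p Y"
  proof
    fix q assume "q \<in> Q"
    then obtain x where q: "prime q" and x: "x \<in> I" "int q dvd F x" by (auto simp: Q_def)
    have "cubic_residue (int q) p" if "Y < real q"
    proof (rule residue)
      show "q \<noteq> 3" using that Y by auto
      show "q \<noteq> p" using ndvd x by auto
    qed (use q x in \<open>auto simp: F_def\<close>)
    moreover have "real q \<le> 72 * sqrt (real p) * Y ^ 3"
    proof (rule power2_le_imp_le)
      have "int q \<le> \<bar>F x\<bar>" using x nz by (intro zdvd_imp_le) auto
      then have "int q ^ 2 \<le> F x ^ 2" using abs_le_square_iff[of "int q" "F x"] by simp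
      then have "27 * int q ^ 2 \<le> 4 * int p * x ^ 6"
        using cform_upper[OF pint am, of x] x unfolding F_def I_def by auto
      then have "real_of_int (27 * int q ^ 2) \<le> real_of_int (4 * int p * x ^ 6)"
        by (simp only: of_int_le_iff)
      then have "27 * real q ^ 2 \<le> 4 * real p * real_of_int x ^ 6" by simp
      also have "\<dots> \<le> 4 * real p * (17 * Y / 3) ^ 6"
        using x n by (intro mult_left_mono power_mono) (auto simp: I_def)
      also have "\<dots> = 4 * (17 / 3) ^ 6 * (real p * Y ^ 6)" by (simp add: power_mult_distrib power_divide)
      also have "\<dots> \<le> 27 * 72 ^ 2 * (real p * Y ^ 6)" using Y by (intro mult_right_mono) (auto simp: field_simps)
      finally have "real q ^ 2 \<le> 72 ^ 2 * (real p * Y ^ 6)" by simp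
      also have "\<dots> = (72 * sqrt (real p) * Y ^ 3) ^ 2"
        by (simp add: power_mult_distrib flip: power_mult)
      finally show "(real q)\<^sup>2 \<le> (72 * sqrt (real p) * Y ^ 3)\<^sup>2" .
    qed (use Y in auto)
    ultimately show "q \<in> {q. prime q \<and> real q \<le> Y} \<union> large_residues p Y"
      using q by (auto simp: large_residues_def)
  qed
  have finQ: "finite Q"
    using QT by (rule finite_subset) (simp add: finite_primes_upto finite_large_residues)
  have cardQ: "real (card Q) \<le> Y / 3 + 11"
  proof -
    have "card Q \<le> card ({q. prime q \<and> real q \<le> Y} \<union> large_residues p Y)"
      using QT by (intro card_mono) (simp_all add: finite_primes_upto finite_large_residues)
    also have "\<dots> \<le> card {q. prime q \<and> real q \<le> Y} + card (large_residues p Y)" by (rule card_Un_le)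
    finally show ?thesis using card_primes_upto[of Y] T Y by simp
  qed
  obtain R where R: "R \<subseteq> I" "card R \<le> 3 * card Q"
    "(\<Prod>x\<in>I - R. \<bar>F x\<bar>) \<le> fact (nat (int n - 2)) ^ 3"
    unfolding I_def
  proof (rule prod_values_le_fact_power[of 2 "int n" F Q 3])
    fix q assume "q \<in> Q"
    then have q: "prime (int q)" "int q \<noteq> int p" using ndvd by (auto simp: Q_def)
    show "card ((\<lambda>x. x mod int q) ` {x \<in> {2..int n}. int q dvd F x}) \<le> 3"
      unfolding F_def by (rule card_roots_cform[OF pint am q(1)]) simp
    show "int q ^ k dvd x - y" if "int q dvd F x" "int q dvd x - y" "int q ^ k dvd F x" "int q ^ k dvd F y" for k x y
      using that unfolding F_def by (rule cform_lift[OF pint am q])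
  qed (use finQ nz in \<open>auto simp: Q_def I_def\<close>)

  \<comment> \<open>Let \<open>x0\<close> minimise the normalised value \<open>h\<close>. For any
    other \<open>x\<close>, \<open>cform_lower\<close> bounds \<open>h x + h x0\<close>, hence
    \<open>2 * h x\<close>, from below in terms of the distance of \<open>x\<close> from
    \<open>x0\<close>.\<close>
  define h where "h = (\<lambda>x. \<bar>F x\<bar> / real_of_int (x ^ 2 - x))"
  have finI: "finite I" "I \<noteq> {}" using n424 by (auto simp: I_def)
  then obtain x0 where x0: "x0 \<in> I" "\<And>x. x \<in> I \<Longrightarrow> h x0 \<le> h x"
    using ex_min_if_finite[of "h ` I"] by (metis arg_min_if_finite(1) arg_min_least)
  define k where "k = n div 50 + 1"
  have k: "real n / 50 \<le> real k" "real k \<le> real n / 50 + 1"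
    unfolding k_def by linarith+
  \<comment> \<open>Besides \<open>R\<close>, a window around \<open>x0\<close> and the arguments up
    to \<open>k\<close> are dropped, so that both the distance to \<open>x0\<close> and
    \<open>x ^ 2 - x\<close> are large. With \<open>k\<close> about \<open>n / 50\<close> this costs
    about \<open>3 * n / 50\<close> arguments.\<close>
  define R' where "R' = R \<union> {x0 - int k<..<x0 + int k} \<union> {2..int k}"
  define B where "B = I - R'"
  have cardB: "real (card B) \<ge> real n - Y - 35 - 3 * real n / 50"
  proof -
    have "card R' \<le> card R + card {x0 - int k<..<x0 + int k} + card {2..int k}"
      unfolding R'_def by (meson add_le_mono1 card_Un_le order_trans)
    moreover have "finite R'" using R(1) finI finite_subset unfolding R'_def by blast
    then have "card B \<ge> card I - card R'" unfolding B_def by (intro diff_card_le_card_Diff)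
    moreover have "card I = n - 1" by (simp add: I_def)
    moreover have "card {x0 - int k<..<x0 + int k} = 2 * k - 1"
      unfolding card_greaterThanLessThan_int by arith
    moreover have "card {2..int k} = k - 1" by simp
    moreover have "k \<ge> 1" by (simp add: k_def)
    ultimately have "n + 1 \<le> card B + card R + 3 * k" using n424 by linarith
    then have "real n + 1 \<le> real (card B) + real (card R) + 3 * real k" by linarith
    then show ?thesis using R(2) cardQ k by linarith
  qed

  \<comment> \<open>From \<open>k \<ge> n / 50\<close>, the bound
    \<open>k ^ 3 * sqrt p / (2 * (n + 3))\<close> is at least \<open>V\<close>, since
    \<open>2 ^ 18\<close> exceeds 250000 by enough to cover the factor
    \<open>(n + 3) / n\<close>.\<close>
  define V where "V = real n ^ 2 * sqrt (real p) / 2 ^ 18"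
  have lower: "V \<le> real_of_int \<bar>F x\<bar>" if "x \<in> B" for x
  proof -
    have x: "x \<in> I" "int k \<le> \<bar>x - x0\<bar>" "int k + 1 \<le> x" using that by (auto simp: B_def R'_def I_def)
    have "sqrt (real p) * real k \<le> sqrt (real p) * \<bar>real_of_int (x - x0)\<bar>"
      using x(2) by (intro mult_left_mono) auto
    also have "\<dots> \<le> (real n + 3) * (h x + h x0)"
      using cform_lower[OF pint am, of x "int n" x0] x(1) x0(1) by (simp add: I_def h_def F_def)
    also have "\<dots> \<le> (real n + 3) * (2 * h x)" using x0(2)[OF x(1)] by (intro mult_left_mono) auto
    finally have 1: "sqrt (real p) * real k \<le> 2 * (real n + 3) * h x" by (simp add: algebra_simps)
    have d: "real k ^ 2 \<le> real_of_int (x ^ 2 - x)"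
    proof -
      have "int k * int k \<le> (x - 1) * x" using x(3) by (intro mult_mono) auto
      then have "int (k ^ 2) \<le> x ^ 2 - x" by (simp add: power2_eq_square algebra_simps)
      then show ?thesis by (metis of_int_le_iff of_int_of_nat_eq of_nat_power)
    qed
    have k0: "real k > 0" by (simp add: k_def)
    then have dpos: "0 < real_of_int (x ^ 2 - x)"
      using d by (meson less_le_trans zero_less_power)
    have hx: "h x = real_of_int \<bar>F x\<bar> / real_of_int (x ^ 2 - x)"
      by (simp only: h_def)
    then have Fx: "real_of_int \<bar>F x\<bar> = h x * real_of_int (x ^ 2 - x)"
      using dpos by (metis less_irrefl nonzero_eq_divide_eq)
    have "h x \<ge> 0"
      unfolding hx using dpos by (intro divide_nonneg_pos) auto
    have "V * (2 * (real n + 3)) \<le> (real n / 50) ^ 3 * sqrt (real p)"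
    proof -
      have "real n ^ 2 * (2 * (real n + 3)) / 2 ^ 18 \<le> real n ^ 2 * (real n / 125000)"
        using n424 by (simp add: field_simps)
      then have "real n ^ 2 * (2 * (real n + 3)) / 2 ^ 18 * sqrt (real p) \<le> real n ^ 2 * (real n / 125000) * sqrt (real p)"
        by (intro mult_right_mono) auto
      then show ?thesis by (simp add: V_def power2_eq_square power3_eq_cube mult_ac)
    qed
    also have "\<dots> \<le> real k ^ 3 * sqrt (real p)"
      using k by (intro mult_right_mono power_mono) auto
    also have "\<dots> = real k ^ 2 * (sqrt (real p) * real k)" by (simp add: power2_eq_square power3_eq_cube)
    also have "\<dots> \<le> real_of_int (x ^ 2 - x) * (2 * (real n + 3) * h x)"
      using 1 d dpos by (intro mult_mono[OF d 1]) auto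
    also have "\<dots> = real_of_int \<bar>F x\<bar> * (2 * (real n + 3))" unfolding Fx by simp
    finally show ?thesis by (rule mult_right_le_imp_le) simp
  qed
  have V: "V > 0" using p0 n424 by (simp add: V_def)
  have "V ^ card B = (\<Prod>x\<in>B. V)" by simp
  also have "\<dots> \<le> (\<Prod>x\<in>B. real_of_int \<bar>F x\<bar>)"
    using lower V by (intro prod_mono) auto
  \<comment> \<open>The arguments put back contribute nonzero integers, so factors of absolute value
    at least 1.\<close>
  also have "\<dots> \<le> (\<Prod>x\<in>I - R. real_of_int \<bar>F x\<bar>)"
  proof (rule prod_mono2)
    show "1 \<le> real_of_int \<bar>F x\<bar>" if "x \<in> (I - R) - B" for x
      using nz[of x] that by (simp add: abs_if)
  qed (use finI in \<open>auto simp: B_def R'_def\<close>)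
  also have "\<dots> = real_of_int (\<Prod>x\<in>I - R. \<bar>F x\<bar>)" by simp
  also have "\<dots> \<le> real_of_int (fact (nat (int n - 2)) ^ 3)" using R(3) by (simp only: of_int_le_iff)
  also have "\<dots> = fact (n - 2) ^ 3" by (simp add: nat_diff_distrib')
  also have "\<dots> \<le> (fact n :: real) ^ 3" by (intro power_mono fact_mono) auto
  finally have "V ^ card B \<le> (fact n :: real) ^ 3" .
  then have "ln (V ^ card B) \<le> ln ((fact n :: real) ^ 3)" using V by (subst ln_le_cancel_iff) auto
  then have "real (card B) * ln V \<le> 3 * ln (fact n)" using V by (simp add: ln_realpow)
  also have "\<dots> \<le> 3 * ((real n + 1) * ln (real n) - real n + 1)"
    using n424 by (intro mult_left_mono ln_fact_le) auto
  also have "\<dots> < real (card B) * (ln (real p) / 2 + 2 * ln (real n) - 63 / 5)"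
  proof (rule final_numerics[OF n424 refl])
    have "ln (exp 100) \<le> ln (real p)" using assms(5) p0 by (subst ln_le_cancel_iff) auto
    then show "100 \<le> ln (real p)" by simp
    have "ln (Y ^ 6) \<le> ln (real p)" using Y p0 by (subst ln_le_cancel_iff) auto
    then show "6 * ln Y \<le> ln (real p)" using Y by (simp add: ln_realpow)
    \<comment> \<open>\<open>n \<le> 17 * Y / 3 < 8 * Y\<close>, and
      \<open>3 * ln 2 \<le> 21 / 10\<close>.\<close>
    have "ln (real n) \<le> ln (2 ^ 3 * Y)" using n Y n424 by (subst ln_le_cancel_iff) auto
    also have "\<dots> = 3 * ln 2 + ln Y" using Y by (subst ln_mult) (simp_all only: ln_realpow, auto)
    finally show "ln (real n) - 21 / 10 \<le> ln Y" using ln_2_le by linarith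
    show "Y \<le> 3 * (real n + 1) / 17" using n by simp
  qed (use cardB in simp)
  also have "ln (real p) / 2 + 2 * ln (real n) - 63 / 5 \<le> ln V"
  proof -
    have "ln V = ln (real n ^ 2) + ln (sqrt (real p)) - ln (2 ^ 18)"
      unfolding V_def using n424 p0 by (simp add: ln_div ln_mult)
    also have "\<dots> = 2 * ln (real n) + ln (real p) / 2 - 18 * ln 2"
      using ln_realpow[of 2 18] n424 p0 by (simp add: ln_realpow ln_sqrt)
    finally show ?thesis using ln_2_le by linarith
  qed
  then have "real (card B) * (ln (real p) / 2 + 2 * ln (real n) - 63 / 5) \<le> real (card B) * ln V"
    by (intro mult_left_mono) auto
  finally show False by simp
qed

section \<open>Passage from \<open>Y\<close> back to \<open>p\<close> and
  \<open>\<epsilon>\<close>\<close>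

theorem theorem2:
  fixes \<epsilon> :: real and p :: nat
  assumes "0 < \<epsilon>" and "\<epsilon> \<le> 1 / 2"
    and "prime p"
    and "real p \<ge> max (75 powr (3 / \<epsilon>)) (exp 100)"
  shows "card {q :: nat. prime q \<and> real p powr (\<epsilon> / 3) < real q
              \<and> real q \<le> 72 * real p powr (1 / 2 + \<epsilon>)
              \<and> cubic_residue (int q) p}
         \<ge> (1 / 15) * real p powr (\<epsilon> / 3)"
proof -
  define Y where "Y = real p powr (\<epsilon> / 3)"
  have p1: "real p \<ge> 1" using assms(3) prime_gt_0_nat[of p] by simp
  have "75 = (75 powr (3 / \<epsilon>)) powr (\<epsilon> / 3)"
    using assms(1) by (simp add: powr_powr)
  also have "\<dots> \<le> Y" unfolding Y_def using assms by (intro powr_mono2) auto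
  finally have Y75: "Y \<ge> 75" .
  have pow: "Y ^ k = real p powr (real k * \<epsilon> / 3)" for k
    unfolding Y_def using p1 by (simp add: powr_realpow[symmetric] powr_powr powr_power mult.commute)
  \<comment> \<open>\<open>Y ^ 6\<close> is \<open>p\<close> to the power
    \<open>2 * \<epsilon>\<close>, and \<open>\<epsilon> \<le> 1 / 2\<close>.\<close>
  have "Y ^ 6 \<le> real p powr 1"
    unfolding pow using assms p1 by (intro powr_mono) auto
  then have Y6: "Y ^ 6 \<le> real p" using p1 by simp
  have "real p powr (1 / 2 + \<epsilon>) = sqrt (real p) * Y ^ 3"
    unfolding pow using p1 by (simp add: powr_add powr_half_sqrt)
  then have set: "{q :: nat. prime q \<and> real p powr (\<epsilon> / 3) < real q
      \<and> real q \<le> 72 * real p powr (1 / 2 + \<epsilon>) \<and> cubic_residue (int q) p} = large_residues p Y"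
    by (simp add: large_residues_def Y_def[symmetric] mult.assoc)
  have "p \<noteq> 3"
  proof
    assume "p = 3"
    then show False using Y6 Y75 power_mono[of 75 Y 6] by simp
  qed
  then have "\<not> 3 dvd p" using assms(3) primes_dvd_imp_eq[of 3 p] by auto
  then have "p mod 3 = 1 \<or> p mod 3 = 2" by presburger
  then have "Y / 15 \<le> real (card (large_residues p Y))"
    using many_large_residues_1_mod_3[OF assms(3) _ Y75 Y6] many_large_residues_2_mod_3[OF assms(3) _ Y75 Y6]
      assms(4) by auto
  then show ?thesis unfolding set by (simp add: Y_def[symmetric])
qed

end
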